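(* Let $a,b\in\mathbb R$, $a\neq 0$, and let $g=\frac1a H(t)e^{-\frac ba t}\in\mathcal D_+^\prime(\mathbb R)$, where $H$ is the Heaviside distribution; $g$ is the Green function of the operator $a\frac{d}{dt}+b$. Then for every $f\in\widehat{\rm span}(\mathcal D_+^\prime(\mathbb R))$ the initial value problem $ay^\prime+by=f(t)$, $y(0)=0$, has a unique solution $y$ in $\widehat{\mathcal E(\mathbb R)}$, given by the formula $$y(t)=(g\star f)(t)-(g\star f)(0)\,e^{-\frac ba t},$$ where $g\star f\in\widehat{\rm span}(\mathcal D_+^\prime(\mathbb R))$ and $(g\star f)(0)\in\widehat{\mathbb C}$.
   Context: Notation: $\mathcal E(\mathbb R)=\mathcal C^\infty(\mathbb R)$ (complex-valued smooth functions), $\mathcal D(\mathbb R)$ = test functions (smooth, compactly supported, complex-valued), $\mathcal D^\prime(\mathbb R)$ = Schwartz distributions, $\mathcal D_+^\prime(\mathbb R)$ = distributions supported in $[0,\infty)$. The algebra $\widehat{\mathcal E(\mathbb R)}$ (Todorov and Vernaeve). For $\varphi\in\mathcal D(\mathbb R)$ let $R_\varphi=\sup\{|x|:\varphi(x)\neq0\}$ if $\varphi\ne0$ and $R_\varphi=1$ if $\varphi=0$. Let $\mathcal D_0=\mathcal D(\mathbb R)$ and for $n\ge1$ let $\mathcal D_n$ be the set of real-valued even $\varphi\in\mathcal D(\mathbb R)$ with $R_\varphi\le 1/n$, $\int\varphi=1$, $\int x^j\varphi(x)\,dx=0$ for $1\le j\le n$, $\int|\varphi|\le 1+\frac1n$,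 and $\sup_x|\varphi^{(j)}(x)|\le R_\varphi^{-2(j+1)}$ for $0\le j\le n$. Fix an ultrafilter $\mathcal U$ on the set $\mathcal D(\mathbb R)$ which contains every $\mathcal D_n$ and is $\mathfrak c^+$-good, $\mathfrak c={\rm card}(\mathbb R)$. A property of $\varphi$ holds "a.e." if the set of $\varphi$ satisfying it belongs to $\mathcal U$. A $\varphi$-net in a set $S$ is a map $\mathcal D(\mathbb R)\to S$, written $(f_\varphi)$. A $\varphi$-net $(A_\varphi)$ in $\mathbb C$ is moderate if $|A_\varphi|\le R_\varphi^{-m}$ a.e. for some $m\in\mathbb N$, and negligible if for all $p\in\mathbb N$, $|A_\varphi|\le R_\varphi^{p}$ a.e. A $\varphi$-net $(f_\varphi)$ in $\mathcal E(\mathbb R)$ is moderate if for every compact $K\subset\mathbb R$ and $j\in\mathbb N_0$ there is $m\in\mathbb N$ with $\sup_{K}|f_\varphi^{(j)}|\le R_\varphi^{-m}$ a.e., and negligible if for every compact $K$, every $j\in\mathbb N_0$ and every $p\in\mathbb N$, $\sup_K|f^{(j)}_\varphi|\le R_\varphi^p$ a.e. $\widehat{\mathbb C}$ and $\widehat{\mathcal E(\mathbb R)}$ are the quotients of moderate nets by negligible nets, with class $q(\cdot)$ and componentwise operations (including differentiation in $\widehat{\mathcal E(\mathbb R)}$); $\widehat{\mathbb R}\subset\widehat{\mathbb C}$ consists of classes of real nets and is ordered by: $q(A_\varphi)\geq 0$ iff it has a representative that is $\ge0$ a.e. $\widehat{\mathbb C}$ is identified with $\{f\in\widehat{\mathcal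 E(\mathbb R)}:f^\prime=0\}$. For $f=q(f_\varphi)\in\widehat{\mathcal E(\mathbb R)}$ and $x\in\mathbb R$, $f(x)=q(f_\varphi(x))\in\widehat{\mathbb C}$. The embedding $\iota:\mathcal D^\prime(\mathbb R)\to\widehat{\mathcal E(\mathbb R)}$ is $\iota(T)=q(T\star\varphi)$ (distributional convolution with $\varphi$). A smooth function $h\in\mathcal E(\mathbb R)$ is identified with $\iota(h)$, which satisfies $\iota(h)(x)=h(x)$ for $x\in\mathbb R$. For $S\subseteq\mathcal D^\prime(\mathbb R)$, $\widehat{\rm span}(S)=\{\sum_{n=1}^m\alpha_n\,\iota(T_n): m\in\mathbb N,\ T_n\in S,\ \alpha_n\in\widehat{\mathbb C}\}\subseteq\widehat{\mathcal E(\mathbb R)}$. For $T\in\mathcal D_+^\prime(\mathbb R)$ and $f=\sum_{n=1}^m\alpha_n\,\iota(T_n)\in\widehat{\rm span}(\mathcal D_+^\prime(\mathbb R))$, $T\star f:=\sum_{n=1}^m\alpha_n\,\iota(T\star T_n)$, where $T\star T_n$ is the usual convolution in $\mathcal D_+^\prime(\mathbb R)$. For a polynomial $P\in\mathbb C[x]$, the Green function of $P(d/dt)$ is the distribution $G\in\mathcal D^\prime(\mathbb R)$ with $P(d/dt)G=\delta$ and $G=0$ on $(-\infty,0)$. *)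

theory Defs
  imports "HOL-Analysis.Analysis" "HOL-Algebra.QuotRing"
begin

definition vd :: "(real \<Rightarrow> complex) \<Rightarrow> real \<Rightarrow> complex" where
  "vd f = (\<lambda>t. vector_derivative f (at t))"

definition smooth :: "(real \<Rightarrow> complex) \<Rightarrow> bool" where
  "smooth f \<longleftrightarrow> (\<forall>j t. (vd ^^ j) f differentiable (at t))"

lemma vd_add:
  assumes "\<And>t. f differentiable (at t)" "\<And>t. g differentiable (at t)"
  shows "vd (\<lambda>t. f t + g t) = (\<lambda>t. vd f t + vd g t)"
  using assms by (auto simp: vd_def fun_eq_iff)

lemma vd_cmult:
  assumes "\<And>t. f differentiable (at t)"
  shows "vd (\<lambda>t. c * f t) = (\<lambda>t. c * vd f t)"
proof
  fix t
  have "(f has_vector_derivative vd f t) (at t)"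
    using assms by (simp add: vd_def vector_derivative_works[symmetric])
  then have "((\<lambda>t. c * f t) has_vector_derivative c * vd f t) (at t)"
    by (rule has_vector_derivative_mult_right)
  then show "vd (\<lambda>t. c * f t) t = c * vd f t"
    by (simp add: vd_def vector_derivative_at)
qed

lemma vd_reflect:
  assumes "\<And>t. f differentiable (at t)"
  shows "vd (\<lambda>t. f (x - t)) = (\<lambda>t. - vd f (x - t))"
proof
  fix t
  have f: "(f has_vector_derivative vd f (x - t)) (at (x - t))"
    using assms by (simp add: vd_def vector_derivative_works[symmetric])
  have "((\<lambda>t. x - t) has_vector_derivative (- 1)) (at t)"
    by (auto intro!: derivative_eq_intros)
  from vector_diff_chain_at[OF this f]
  show "vd (\<lambda>t. f (x - t)) t = - vd f (x - t)"
    by (simp add: vd_def o_def vector_derivative_at)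
qed

lemma vd_iterate_add:
  assumes "smooth f" "smooth g"
  shows "(vd ^^ j) (\<lambda>t. f t + g t) = (\<lambda>t. (vd ^^ j) f t + (vd ^^ j) g t)"
  by (induction j) (use assms in \<open>auto simp: smooth_def intro!: vd_add\<close>)

lemma vd_iterate_cmult:
  assumes "smooth f"
  shows "(vd ^^ j) (\<lambda>t. c * f t) = (\<lambda>t. c * (vd ^^ j) f t)"
  by (induction j) (use assms in \<open>auto simp: smooth_def intro!: vd_cmult\<close>)

lemma smooth_add: "smooth f \<Longrightarrow> smooth g \<Longrightarrow> smooth (\<lambda>t. f t + g t)"
  unfolding smooth_def[of "\<lambda>t. f t + g t"]
  by (auto simp: vd_iterate_add smooth_def)

lemma smooth_cmult: "smooth f \<Longrightarrow> smooth (\<lambda>t. c * f t)"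
  unfolding smooth_def[of "\<lambda>t. c * f t"]
  by (auto simp: vd_iterate_cmult smooth_def)

lemma smooth_zero: "smooth (\<lambda>t. 0)"
proof -
  have "(vd ^^ j) (\<lambda>t. 0) = (\<lambda>t. 0)" for j
    by (induction j) (simp_all add: vd_def)
  then show ?thesis by (simp add: smooth_def)
qed

lemma smooth_vd: "smooth f \<Longrightarrow> smooth (vd f)"
  unfolding smooth_def by (metis funpow_Suc_right comp_apply)

lemma differentiable_reflect:
  fixes f :: "real \<Rightarrow> complex"
  assumes "f differentiable (at (x - t))"
  shows "(\<lambda>t. f (x - t)) differentiable (at t)"
  using differentiable_chain_at[of "\<lambda>t. x - t" t f] assms by (simp add: o_def)

lemma vd_iterate_reflect:
  assumes "smooth f"
  shows "(vd ^^ j) (\<lambda>t. f (x - t)) = (\<lambda>t. (- 1) ^ j * (vd ^^ j) f (x - t))"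
proof (induction j)
  case (Suc j)
  have d: "\<And>t. (vd ^^ j) f differentiable (at t)" using assms by (simp add: smooth_def)
  have "vd (\<lambda>t. (- 1) ^ j * (vd ^^ j) f (x - t)) = (\<lambda>t. (- 1) ^ j * vd (\<lambda>t. (vd ^^ j) f (x - t)) t)"
    by (rule vd_cmult) (rule differentiable_reflect[OF d])
  then show ?case by (simp add: Suc vd_reflect[OF d])
qed simp

lemma smooth_reflect: "smooth f \<Longrightarrow> smooth (\<lambda>t. f (x - t))"
  unfolding smooth_def[of "\<lambda>t. f (x - t)"]
  unfolding vd_iterate_reflect
  by (simp add: smooth_def differentiable_mult differentiable_reflect)

typedef test_fun = "{\<phi> :: real \<Rightarrow> complex. smooth \<phi> \<and> compact (closure {x. \<phi> x \<noteq> 0})}"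
  morphisms fn Abs_test_fun
  by (rule exI[of _ "\<lambda>t. 0"]) (simp add: smooth_zero)

setup_lifting type_definition_test_fun

instantiation test_fun :: "{zero, plus}"
begin

lift_definition zero_test_fun :: test_fun is "\<lambda>t. 0"
  by (simp add: smooth_zero)

lift_definition plus_test_fun :: "test_fun \<Rightarrow> test_fun \<Rightarrow> test_fun" is "\<lambda>\<phi> \<psi> t. \<phi> t + \<psi> t"
proof -
  fix \<phi> \<psi> :: "real \<Rightarrow> complex"
  assume A: "smooth \<phi> \<and> compact (closure {x. \<phi> x \<noteq> 0})"
    and B: "smooth \<psi> \<and> compact (closure {x. \<psi> x \<noteq> 0})"
  have "bounded ({x. \<phi> x \<noteq> 0} \<union> {x. \<psi> x \<noteq> 0})"
    using A B by (simp add: compact_closure)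
  then have "bounded {x. \<phi> x + \<psi> x \<noteq> 0}"
    by (rule bounded_subset) auto
  then show "smooth (\<lambda>t. \<phi> t + \<psi> t) \<and> compact (closure {x. \<phi> x + \<psi> x \<noteq> 0})"
    using A B by (simp add: compact_closure smooth_add)
qed

instance ..

end

lift_definition scale_test :: "complex \<Rightarrow> test_fun \<Rightarrow> test_fun" is "\<lambda>c \<phi> t. c * \<phi> t"
proof -
  fix c and \<phi> :: "real \<Rightarrow> complex"
  assume A: "smooth \<phi> \<and> compact (closure {x. \<phi> x \<noteq> 0})"
  then have "bounded {x. \<phi> x \<noteq> 0}" by (simp add: compact_closure)
  then have "bounded {x. c * \<phi> x \<noteq> 0}" by (rule bounded_subset) auto
  then show "smooth (\<lambda>t. c * \<phi> t) \<and> compact (closure {x. c * \<phi> x \<noteq> 0})"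
    using A by (simp add: compact_closure smooth_cmult)
qed

lift_definition deriv_test :: "test_fun \<Rightarrow> test_fun" is vd
proof -
  fix \<phi> :: "real \<Rightarrow> complex"
  assume A: "smooth \<phi> \<and> compact (closure {x. \<phi> x \<noteq> 0})"
  have "vd \<phi> t = 0" if "t \<notin> closure {x. \<phi> x \<noteq> 0}" for t
  proof -
    have "eventually (\<lambda>s. s \<in> - closure {x. \<phi> x \<noteq> 0}) (nhds t)"
      using that by (intro eventually_nhds_in_open) auto
    then have "eventually (\<lambda>s. \<phi> s = 0) (nhds t)"
      by (rule eventually_mono) (use closure_subset[of "{x. \<phi> x \<noteq> 0}"] in auto)
    then have "vector_derivative \<phi> (at t) = vector_derivative (\<lambda>s. 0) (at t)"
      by (intro vector_derivative_cong_eq) (auto elim: eventually_mono)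
    then show ?thesis by (simp add: vd_def)
  qed
  then have "{x. vd \<phi> x \<noteq> 0} \<subseteq> closure {x. \<phi> x \<noteq> 0}" by auto
  then show "smooth (vd \<phi>) \<and> compact (closure {x. vd \<phi> x \<noteq> 0})"
    using A bounded_subset[of "closure {x. \<phi> x \<noteq> 0}" "{x. vd \<phi> x \<noteq> 0}"]
    by (simp add: smooth_vd compact_imp_bounded)
qed

lift_definition reflect_test :: "real \<Rightarrow> test_fun \<Rightarrow> test_fun" is "\<lambda>x \<phi> y. \<phi> (x - y)"
proof -
  fix x and \<phi> :: "real \<Rightarrow> complex"
  assume A: "smooth \<phi> \<and> compact (closure {x. \<phi> x \<noteq> 0})"
  have "{y. \<phi> (x - y) \<noteq> 0} = (\<lambda>z. x - z) ` {z. \<phi> z \<noteq> 0}"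
  proof (intro equalityI subsetI)
    fix y assume "y \<in> {y. \<phi> (x - y) \<noteq> 0}"
    then show "y \<in> (\<lambda>z. x - z) ` {z. \<phi> z \<noteq> 0}"
      by (intro image_eqI[of _ _ "x - y"]) simp_all
  qed auto
  moreover have "bounded ((\<lambda>z. x - z) ` {z. \<phi> z \<noteq> 0})"
  proof -
    have "bounded (uminus ` {z. \<phi> z \<noteq> 0})"
      using A by (intro bounded_linear_image bounded_linear_minus bounded_linear_ident)
        (simp add: compact_closure)
    from bounded_translation[OF this, of x] show ?thesis
      by (simp add: image_image)
  qed
  ultimately show "smooth (\<lambda>y. \<phi> (x - y)) \<and> compact (closure {y. \<phi> (x - y) \<noteq> 0})"
    using A by (simp add: smooth_reflect compact_closure)
qed

definition distributions :: "(test_fun \<Rightarrow> complex) set" where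
  "distributions = {T.
     (\<forall>\<phi> \<psi>. T (\<phi> + \<psi>) = T \<phi> + T \<psi>) \<and>
     (\<forall>c \<phi>. T (scale_test c \<phi>) = c * T \<phi>) \<and>
     (\<forall>K. compact K \<longrightarrow> (\<exists>C N. \<forall>\<phi>. closure {x. fn \<phi> x \<noteq> 0} \<subseteq> K \<longrightarrow>
        cmod (T \<phi>) \<le> C * (\<Sum>j\<le>N. SUP x. cmod ((vd ^^ j) (fn \<phi>) x))))}"

definition vanishes_on :: "(test_fun \<Rightarrow> complex) \<Rightarrow> real set \<Rightarrow> bool" where
  "vanishes_on T A \<longleftrightarrow> (\<forall>\<phi>. closure {x. fn \<phi> x \<noteq> 0} \<subseteq> A \<longrightarrow> T \<phi> = 0)"

definition distributions_plus :: "(test_fun \<Rightarrow> complex) set" where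
  "distributions_plus = {T \<in> distributions. vanishes_on T {..<0}}"

definition regular_dist :: "(real \<Rightarrow> complex) \<Rightarrow> test_fun \<Rightarrow> complex" where
  "regular_dist u \<phi> = (LINT t|lborel. u t * fn \<phi> t)"

definition heaviside :: "real \<Rightarrow> real" where
  "heaviside t = (if t \<ge> 0 then 1 else 0)"

definition dirac :: "test_fun \<Rightarrow> complex" where
  "dirac \<phi> = fn \<phi> 0"

definition dist_deriv :: "(test_fun \<Rightarrow> complex) \<Rightarrow> test_fun \<Rightarrow> complex" where
  "dist_deriv T \<phi> = - T (deriv_test \<phi>)"

definition poly_diff_op :: "complex poly \<Rightarrow> (test_fun \<Rightarrow> complex) \<Rightarrow> test_fun \<Rightarrow> complex" where
  "poly_diff_op P T \<phi> = (\<Sum>k\<le>degree P. coeff P k * (dist_deriv ^^ k) T \<phi>)"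

definition green_function :: "complex poly \<Rightarrow> test_fun \<Rightarrow> complex" where
  "green_function P =
     (THE G. G \<in> distributions \<and> poly_diff_op P G = dirac \<and> vanishes_on G {..<0})"

definition dist_conv_test :: "(test_fun \<Rightarrow> complex) \<Rightarrow> test_fun \<Rightarrow> real \<Rightarrow> complex" where
  "dist_conv_test T \<phi> = (\<lambda>x. T (reflect_test x \<phi>))"

definition cutoff :: "real \<Rightarrow> complex" where
  "cutoff = (SOME \<theta>. smooth \<theta> \<and> (\<forall>x\<ge>-1. \<theta> x = 1) \<and> (\<forall>x\<le>-2. \<theta> x = 0))"

text \<open>
  The convolution of distributions supported in $[0,\infty)$ is
  $\langle T \star S, \varphi\rangle = \langle T_x, \langle S_y, \varphi(x + y)\rangle\rangle$.
  The function $x \mapsto \langle S_y, \varphi(x + y)\rangle$ is smooth with support bounded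
  above, but not below; multiplying it by a cutoff that is $1$ near $[0,\infty)$ makes it a test
  function and does not change the pairing with $T$. Here $\varphi(x + y)$ as a function of $y$ is
  the reflection about $0$ followed by a reflection about $-x$.
\<close>
definition dist_conv ::
    "(test_fun \<Rightarrow> complex) \<Rightarrow> (test_fun \<Rightarrow> complex) \<Rightarrow> test_fun \<Rightarrow> complex" where
  "dist_conv T S \<phi> =
     T (Abs_test_fun (\<lambda>x. cutoff x * S (reflect_test (- x) (reflect_test 0 \<phi>))))"

definition radius :: "test_fun \<Rightarrow> real" where
  "radius \<phi> = (if \<phi> = 0 then 1 else Sup {\<bar>x\<bar> | x. fn \<phi> x \<noteq> 0})"

definition mollifiers :: "nat \<Rightarrow> test_fun set" where
  "mollifiers n = (if n = 0 then UNIV else {\<phi>.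
     (\<forall>x. fn \<phi> x \<in> \<real>) \<and> (\<forall>x. fn \<phi> (- x) = fn \<phi> x) \<and>
     radius \<phi> \<le> 1 / real n \<and>
     (LINT x|lborel. fn \<phi> x) = 1 \<and>
     (\<forall>j\<in>{1..n}. (LINT x|lborel. of_real (x ^ j) * fn \<phi> x) = 0) \<and>
     (LINT x|lborel. cmod (fn \<phi> x)) \<le> 1 + 1 / real n \<and>
     (\<forall>j\<le>n. \<forall>x. cmod ((vd ^^ j) (fn \<phi>) x) \<le> 1 / radius \<phi> ^ (2 * (j + 1)))})"

text \<open>
  Ultrafilters are represented by elements of the type of filters; a set \<open>A\<close> belongs to \<open>U\<close> iff
  \<open>\<forall>\<^sub>F \<phi> in U. \<phi> \<in> A\<close>.
\<close>
definition is_ultrafilter :: "'i filter \<Rightarrow> bool" where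
  "is_ultrafilter U \<longleftrightarrow>
     U \<noteq> bot \<and> (\<forall>P. (\<forall>\<^sub>F i in U. P i) \<or> (\<forall>\<^sub>F i in U. \<not> P i))"

text \<open>
  An ultrafilter is $\mathfrak c^+$-good if every antitone map \<open>R\<close> from the finite subsets of a set
  \<open>\<Gamma>\<close> of cardinality at most $\mathfrak c$ into the ultrafilter has a refinement \<open>S\<close> with
  $S(X \cup Y) = S(X) \cap S(Y)$. Only the cardinality of \<open>\<Gamma>\<close> matters, so it suffices to let
  \<open>\<Gamma>\<close> range over the sets of real numbers.
\<close>
definition continuum_succ_good :: "'i filter \<Rightarrow> bool" where
  "continuum_succ_good U \<longleftrightarrow> (\<forall>(\<Gamma> :: real set) (R :: real set \<Rightarrow> 'i set).
     (\<forall>X\<in>Fpow \<Gamma>. \<forall>\<^sub>F i in U. i \<in> R X) \<and>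
     (\<forall>X\<in>Fpow \<Gamma>. \<forall>Y\<in>Fpow \<Gamma>. X \<subseteq> Y \<longrightarrow> R Y \<subseteq> R X) \<longrightarrow>
     (\<exists>S :: real set \<Rightarrow> 'i set.
        (\<forall>X\<in>Fpow \<Gamma>. \<forall>\<^sub>F i in U. i \<in> S X) \<and>
        (\<forall>X\<in>Fpow \<Gamma>. \<forall>Y\<in>Fpow \<Gamma>. S (X \<union> Y) = S X \<inter> S Y) \<and>
        (\<forall>X\<in>Fpow \<Gamma>. S X \<subseteq> R X)))"

definition admissible_ultrafilter :: "test_fun filter \<Rightarrow> bool" where
  "admissible_ultrafilter U \<longleftrightarrow>
     is_ultrafilter U \<and> (\<forall>n. \<forall>\<^sub>F \<phi> in U. \<phi> \<in> mollifiers n) \<and> continuum_succ_good U"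

definition moderate_C :: "test_fun filter \<Rightarrow> (test_fun \<Rightarrow> complex) set" where
  "moderate_C U = {A. \<exists>m::nat. \<forall>\<^sub>F \<phi> in U. cmod (A \<phi>) \<le> 1 / radius \<phi> ^ m}"

definition negligible_C :: "test_fun filter \<Rightarrow> (test_fun \<Rightarrow> complex) set" where
  "negligible_C U = {A. \<forall>p::nat. \<forall>\<^sub>F \<phi> in U. cmod (A \<phi>) \<le> radius \<phi> ^ p}"

definition moderate_E :: "test_fun filter \<Rightarrow> (test_fun \<Rightarrow> real \<Rightarrow> complex) set" where
  "moderate_E U = {f. (\<forall>\<phi>. smooth (f \<phi>)) \<and>
     (\<forall>K j. compact K \<longrightarrow>
        (\<exists>m::nat. \<forall>\<^sub>F \<phi> in U. \<forall>t\<in>K. cmod ((vd ^^ j) (f \<phi>) t) \<le> 1 / radius \<phi> ^ m))}"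

definition negligible_E :: "test_fun filter \<Rightarrow> (test_fun \<Rightarrow> real \<Rightarrow> complex) set" where
  "negligible_E U = {f. (\<forall>\<phi>. smooth (f \<phi>)) \<and>
     (\<forall>K j. compact K \<longrightarrow>
        (\<forall>p::nat. \<forall>\<^sub>F \<phi> in U. \<forall>t\<in>K. cmod ((vd ^^ j) (f \<phi>) t) \<le> radius \<phi> ^ p))}"

definition moderate_ring_C :: "test_fun filter \<Rightarrow> (test_fun \<Rightarrow> complex) ring" where
  "moderate_ring_C U = \<lparr>carrier = moderate_C U,
     mult = (\<lambda>A B \<phi>. A \<phi> * B \<phi>), one = (\<lambda>\<phi>. 1),
     zero = (\<lambda>\<phi>. 0), add = (\<lambda>A B \<phi>. A \<phi> + B \<phi>)\<rparr>"

definition moderate_ring_E :: "test_fun filter \<Rightarrow> (test_fun \<Rightarrow> real \<Rightarrow> complex) ring" where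
  "moderate_ring_E U = \<lparr>carrier = moderate_E U,
     mult = (\<lambda>f g \<phi> t. f \<phi> t * g \<phi> t), one = (\<lambda>\<phi> t. 1),
     zero = (\<lambda>\<phi> t. 0), add = (\<lambda>f g \<phi> t. f \<phi> t + g \<phi> t)\<rparr>"

definition C_hat :: "test_fun filter \<Rightarrow> (test_fun \<Rightarrow> complex) set ring" where
  "C_hat U = moderate_ring_C U Quot negligible_C U"

definition E_hat :: "test_fun filter \<Rightarrow> (test_fun \<Rightarrow> real \<Rightarrow> complex) set ring" where
  "E_hat U = moderate_ring_E U Quot negligible_E U"

definition class_C ::
    "test_fun filter \<Rightarrow> (test_fun \<Rightarrow> complex) \<Rightarrow> (test_fun \<Rightarrow> complex) set" where
  "class_C U A = negligible_C U +>\<^bsub>moderate_ring_C U\<^esub> A"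

definition class_E ::
    "test_fun filter \<Rightarrow> (test_fun \<Rightarrow> real \<Rightarrow> complex) \<Rightarrow> (test_fun \<Rightarrow> real \<Rightarrow> complex) set" where
  "class_E U f = negligible_E U +>\<^bsub>moderate_ring_E U\<^esub> f"

text \<open>
  The following operations on classes are given by operations on representatives; the result does
  not depend on the representative, so the unions are unions of equal cosets.
\<close>

definition deriv_hat ::
    "test_fun filter \<Rightarrow> (test_fun \<Rightarrow> real \<Rightarrow> complex) set \<Rightarrow> (test_fun \<Rightarrow> real \<Rightarrow> complex) set" where
  "deriv_hat U F = (\<Union>f\<in>F. class_E U (\<lambda>\<phi>. vd (f \<phi>)))"

definition value_hat ::
    "test_fun filter \<Rightarrow> (test_fun \<Rightarrow> real \<Rightarrow> complex) set \<Rightarrow> real \<Rightarrow> (test_fun \<Rightarrow> complex) set" where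
  "value_hat U F x = (\<Union>f\<in>F. class_C U (\<lambda>\<phi>. f \<phi> x))"

text \<open>
  A generalized number is identified with the generalized function, of derivative zero, that is
  represented by a net of constant functions.
\<close>
definition const_hat ::
    "test_fun filter \<Rightarrow> (test_fun \<Rightarrow> complex) set \<Rightarrow> (test_fun \<Rightarrow> real \<Rightarrow> complex) set" where
  "const_hat U \<alpha> = (\<Union>A\<in>\<alpha>. class_E U (\<lambda>\<phi> t. A \<phi>))"

definition scale_hat ::
    "test_fun filter \<Rightarrow> (test_fun \<Rightarrow> complex) set \<Rightarrow> (test_fun \<Rightarrow> real \<Rightarrow> complex) set
       \<Rightarrow> (test_fun \<Rightarrow> real \<Rightarrow> complex) set" where
  "scale_hat U \<alpha> F = const_hat U \<alpha> \<otimes>\<^bsub>E_hat U\<^esub> F"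

definition number_hat :: "test_fun filter \<Rightarrow> complex \<Rightarrow> (test_fun \<Rightarrow> complex) set" where
  "number_hat U c = class_C U (\<lambda>\<phi>. c)"

definition iota ::
    "test_fun filter \<Rightarrow> (test_fun \<Rightarrow> complex) \<Rightarrow> (test_fun \<Rightarrow> real \<Rightarrow> complex) set" where
  "iota U T = class_E U (\<lambda>\<phi>. dist_conv_test T \<phi>)"

definition lin_comb ::
    "test_fun filter \<Rightarrow> nat \<Rightarrow> (nat \<Rightarrow> (test_fun \<Rightarrow> complex) set)
       \<Rightarrow> (nat \<Rightarrow> test_fun \<Rightarrow> complex) \<Rightarrow> (test_fun \<Rightarrow> real \<Rightarrow> complex) set" where
  "lin_comb U m \<alpha> T = (\<Oplus>\<^bsub>E_hat U\<^esub>n\<in>{1..m}. scale_hat U (\<alpha> n) (iota U (T n)))"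

definition span_hat ::
    "test_fun filter \<Rightarrow> (test_fun \<Rightarrow> complex) set \<Rightarrow> (test_fun \<Rightarrow> real \<Rightarrow> complex) set set" where
  "span_hat U S = {lin_comb U m \<alpha> T | m \<alpha> T.
     \<forall>n\<in>{1..m}. \<alpha> n \<in> carrier (C_hat U) \<and> T n \<in> S}"

text \<open>
  A definite description rather than a choice: it denotes the intended value only because
  $\sum_n \alpha_n \iota(T \star T_n)$ does not depend on the representation
  $f = \sum_n \alpha_n \iota(T_n)$.
\<close>
definition conv_hat ::
    "test_fun filter \<Rightarrow> (test_fun \<Rightarrow> complex) \<Rightarrow> (test_fun \<Rightarrow> real \<Rightarrow> complex) set
       \<Rightarrow> (test_fun \<Rightarrow> real \<Rightarrow> complex) set" where
  "conv_hat U T f = (THE h. \<exists>m \<alpha> S.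
     (\<forall>n\<in>{1..m}. \<alpha> n \<in> carrier (C_hat U) \<and> S n \<in> distributions_plus) \<and>
     f = lin_comb U m \<alpha> S \<and> h = lin_comb U m \<alpha> (\<lambda>n. dist_conv T (S n)))"

definition solves_ivp ::
    "test_fun filter \<Rightarrow> real \<Rightarrow> real \<Rightarrow> (test_fun \<Rightarrow> real \<Rightarrow> complex) set
       \<Rightarrow> (test_fun \<Rightarrow> real \<Rightarrow> complex) set \<Rightarrow> bool" where
  "solves_ivp U a b f y \<longleftrightarrow>
     y \<in> carrier (E_hat U) \<and>
     scale_hat U (number_hat U (of_real a)) (deriv_hat U y)
       \<oplus>\<^bsub>E_hat U\<^esub> scale_hat U (number_hat U (of_real b)) y = f \<and>
     value_hat U y 0 = \<zero>\<^bsub>C_hat U\<^esub>"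

end

theory Submission
  imports Defs
begin

text \<open>
  The idea is to work with representatives and to solve the equation there exactly. Convolution with
  a test function commutes with the derivative of distributions, and \<open>g \<star> S\<close> satisfies
  \<open>a (g \<star> S)' + b (g \<star> S) = S\<close> for every \<open>S\<close> supported in \<open>[0, \<infinity>)\<close>, which is an integration by parts
  on \<open>[0, \<infinity>)\<close> (\<open>dist_conv_green_equation\<close>). Hence the obvious representative of \<open>g \<star> f\<close> solves the
  equation for the obvious representative of \<open>f\<close>, for every single \<open>\<phi>\<close>. Subtracting
  \<open>(g \<star> f)(0) e\<^bsup>-(b/a)t\<^esup>\<close> corrects the initial value. Here the embedded exponential function may be
  replaced by the constant net of the exponential function itself: the two differ by the factor
  \<open>\<integral> e\<^bsup>(b/a)s\<^esup> \<phi>(s) ds\<close>, which is \<open>1\<close> up to a negligible number because the moments of \<open>\<phi>\<close> vanish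
  (\<open>mollified_exp_negligible\<close>, \<open>iota_exp\<close>).

  Every uniqueness statement rests on one a priori estimate (\<open>linear_ode_estimate\<close>): on a bounded
  interval, a smooth \<open>y\<close> is bounded by a constant times \<open>|y(x\<^sub>0)| + sup |a y' + b y|\<close>. The constant does
  not depend on \<open>\<phi>\<close>. So a moderate net for which \<open>a y' + b y\<close> and the value at one point are negligible is
  negligible; the derivatives follow from the equation (\<open>linear_ode_negligible\<close>). This has three uses.

  \<^item> At the point \<open>0\<close> it gives the uniqueness of the solution of the initial value problem.

  \<^item> At the point \<open>-1\<close> it shows that \<open>g \<star> f\<close> does not depend on the representation of \<open>f\<close> as a linear
    combination. Two representations lead to two solutions of the same equation, and both vanish at
    \<open>-1\<close> as soon as \<open>R\<^sub>\<phi> < 1\<close>, because all distributions involved are supported in \<open>[0, \<infinity>)\<close>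
    (\<open>conv_hat_green\<close>).

  \<^item> Applied to the regularizations \<open>T \<star> \<phi>\<close> of the difference \<open>T\<close> of two fundamental solutions, it gives
    the uniqueness of the Green function (\<open>homogeneous_solution_vanishing\<close>, \<open>green_function_eq\<close>).

  What remains is the construction of the setting: distributions may be differentiated under the
  convolution with a test function, so that \<open>T \<star> \<phi>\<close> is smooth and moderate, the moderate nets form a
  ring in which the negligible nets are an ideal, and a smooth cutoff exists, without which the
  convolution of distributions would not be the intended one.
\<close>

section \<open>Calculus of smooth functions\<close>

lemma smooth_differentiable: "smooth f \<Longrightarrow> f differentiable (at t)"
  unfolding smooth_def by (metis funpow_0)

lemma smooth_has_vector_derivative: "smooth f \<Longrightarrow> (f has_vector_derivative vd f t) (at t)"
  by (simp add: vd_def vector_derivative_works[symmetric] smooth_differentiable)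

lemma vd_eqI: "(\<And>t. (f has_vector_derivative f' t) (at t)) \<Longrightarrow> vd f = f'"
  by (auto simp: vd_def vector_derivative_at)

lemma smooth_iterate: "smooth f \<Longrightarrow> smooth ((vd ^^ j) f)"
  by (induction j) (auto simp: smooth_vd)

lemma smooth_continuous_on: "smooth f \<Longrightarrow> continuous_on S f"
  by (meson continuous_at_imp_continuous_on differentiable_imp_continuous_within smooth_differentiable)

lemma vd_iterate_vd: "(vd ^^ j) (vd f) = (vd ^^ Suc j) f"
  by (simp add: funpow_swap1)

text \<open>
  The derivatives of a function are rarely known in closed form, but the function often lies in a
  family that is closed under differentiation. Such a family consists of smooth functions.
\<close>
lemma smooth_coinduct:
  assumes P: "P f"
    and step: "\<And>f. P f \<Longrightarrow> \<exists>f'. P f' \<and> (\<forall>t. (f has_vector_derivative f' t) (at t))"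
  shows "smooth f"
proof -
  have "P ((vd ^^ j) f)" for j
    using P step vd_eqI by (induction j) (force, metis comp_apply funpow.simps(2))
  then show ?thesis
    unfolding smooth_def by (meson step differentiableI_vector)
qed

lemma smooth_const: "smooth (\<lambda>t. c)"
  by (rule smooth_coinduct[of "\<lambda>f. \<exists>c. f = (\<lambda>t. c)"])
    (auto intro!: exI[of _ "\<lambda>t. 0"])

text \<open>
  Derivatives of a product or a quotient of smooth functions leave the class of products and
  quotients, but stay in the algebra generated by the smooth functions and the reciprocal. This
  algebra is therefore closed under differentiation, which avoids an explicit Leibniz formula.
\<close>
inductive recip_algebra :: "(real \<Rightarrow> complex) \<Rightarrow> (real \<Rightarrow> complex) \<Rightarrow> bool" for g where
  smooth: "smooth f \<Longrightarrow> recip_algebra g f"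
| recip: "recip_algebra g (\<lambda>t. inverse (g t))"
| add: "recip_algebra g u \<Longrightarrow> recip_algebra g v \<Longrightarrow> recip_algebra g (\<lambda>t. u t + v t)"
| mult: "recip_algebra g u \<Longrightarrow> recip_algebra g v \<Longrightarrow> recip_algebra g (\<lambda>t. u t * v t)"

lemma recip_algebra_smooth:
  assumes g: "smooth g" "\<And>t. g t \<noteq> 0" and "recip_algebra g f"
  shows "smooth f"
proof (rule smooth_coinduct[of "recip_algebra g"])
  fix f assume "recip_algebra g f"
  then show "\<exists>f'. recip_algebra g f' \<and> (\<forall>t. (f has_vector_derivative f' t) (at t))"
  proof induction
    case (smooth f)
    then show ?case
      by (intro exI[of _ "vd f"]) (auto simp: smooth_vd recip_algebra.smooth smooth_has_vector_derivative)
  next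
    case recip
    have "((\<lambda>t. inverse (g t)) has_vector_derivative - 1 * vd g t * (inverse (g t) * inverse (g t))) (at t)" for t
      using field_vector_diff_chain_at[OF smooth_has_vector_derivative[OF g(1), of t] DERIV_inverse[OF g(2)[of t]]]
      by (simp add: o_def power2_eq_square)
    moreover have "recip_algebra g (\<lambda>t. - 1 * vd g t * (inverse (g t) * inverse (g t)))"
      by (intro recip_algebra.mult recip_algebra.recip recip_algebra.smooth smooth_cmult smooth_vd g)
    ultimately show ?case by blast
  next
    case (add u v)
    then obtain u' v' where "recip_algebra g u'" "recip_algebra g v'"
      "\<And>t. (u has_vector_derivative u' t) (at t)" "\<And>t. (v has_vector_derivative v' t) (at t)" by blast
    then show ?case
      by (intro exI[of _ "\<lambda>t. u' t + v' t"]) (auto intro: recip_algebra.add has_vector_derivative_add)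
  next
    case (mult u v)
    then obtain u' v' where "recip_algebra g u'" "recip_algebra g v'"
      "\<And>t. (u has_vector_derivative u' t) (at t)" "\<And>t. (v has_vector_derivative v' t) (at t)" by blast
    with mult.hyps show ?case
      by (intro exI[of _ "\<lambda>t. u t * v' t + u' t * v t"])
        (auto intro!: recip_algebra.add recip_algebra.mult has_vector_derivative_mult)
  qed
qed fact

lemma smooth_mult: "smooth f \<Longrightarrow> smooth g \<Longrightarrow> smooth (\<lambda>t. f t * g t)"
  by (rule recip_algebra_smooth[of "\<lambda>_. 1"]) (auto intro: recip_algebra.intros smooth_const)

lemma smooth_divide: "smooth f \<Longrightarrow> smooth g \<Longrightarrow> (\<And>t. g t \<noteq> 0) \<Longrightarrow> smooth (\<lambda>t. f t / g t)"
  unfolding divide_inverse by (rule recip_algebra_smooth[of g]) (auto intro: recip_algebra.intros)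

lemma vd_diff: "smooth f \<Longrightarrow> smooth g \<Longrightarrow> vd (\<lambda>t. f t - g t) = (\<lambda>t. vd f t - vd g t)"
  by (rule vd_eqI) (intro has_vector_derivative_diff smooth_has_vector_derivative)

lemma vd_mult:
  assumes "smooth f" "smooth g"
  shows "vd (\<lambda>t. f t * g t) = (\<lambda>t. vd f t * g t + f t * vd g t)"
  by (rule vd_eqI)
    (use has_vector_derivative_mult[OF smooth_has_vector_derivative[OF assms(1)]
       smooth_has_vector_derivative[OF assms(2)]] in \<open>simp add: add.commute\<close>)

lemma has_vector_derivative_exp_real:
  "((\<lambda>t. complex_of_real (exp (c * t))) has_vector_derivative of_real c * of_real (exp (c * t))) (at t)"
proof -
  have "((\<lambda>t. exp (c * t)) has_real_derivative exp (c * t) * c) (at t)"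
    by (auto intro!: derivative_eq_intros)
  from has_vector_derivative_of_real[OF this] show ?thesis
    by (simp add: mult.commute)
qed

lemma smooth_exp_real: "smooth (\<lambda>t. of_real (exp (c * t)))"
proof (rule smooth_coinduct[of "\<lambda>f. \<exists>d. f = (\<lambda>t. d * of_real (exp (c * t)))"])
  show "\<exists>d. (\<lambda>t. complex_of_real (exp (c * t))) = (\<lambda>t. d * of_real (exp (c * t)))"
    by (rule exI[of _ 1]) simp
next
  fix f assume "\<exists>d. f = (\<lambda>t. d * complex_of_real (exp (c * t)))"
  then obtain d where "f = (\<lambda>t. d * complex_of_real (exp (c * t)))" by blast
  then show "\<exists>f'. (\<exists>d. f' = (\<lambda>t. d * of_real (exp (c * t)))) \<and>
      (\<forall>t. (f has_vector_derivative f' t) (at t))"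
    using has_vector_derivative_mult_right[OF has_vector_derivative_exp_real[of c]]
    by (intro exI[of _ "\<lambda>t. d * of_real c * of_real (exp (c * t))"]) (auto simp: mult.assoc intro: exI[of _ "d * of_real c"])
qed

lemma vd_exp_real: "vd (\<lambda>t. of_real (exp (c * t))) = (\<lambda>t. of_real c * of_real (exp (c * t)))"
  by (rule vd_eqI) (rule has_vector_derivative_exp_real)

section \<open>A smooth cutoff\<close>

text \<open>
  The functions \<open>P(1/x) e\<^bsup>-1/x\<^esup>\<close>, extended by \<open>0\<close> to \<open>x \<le> 0\<close>. All polynomials \<open>P\<close> are needed, as the family
  has to be closed under differentiation; \<open>P = 1\<close> is the usual smooth function that is flat at \<open>0\<close>.
\<close>
definition flat_fun :: "real poly \<Rightarrow> real \<Rightarrow> complex" where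
  "flat_fun P x = (if x > 0 then of_real (poly P (1 / x) * exp (- (1 / x))) else 0)"

lemma poly_exp_tendsto_0: "((\<lambda>x. poly P x * exp (- x)) \<longlongrightarrow> (0::real)) at_top"
proof -
  have "((\<lambda>x. \<Sum>i\<le>degree P. coeff P i * (x ^ i / exp x)) \<longlongrightarrow> (\<Sum>i\<le>degree P. coeff P i * 0)) at_top"
    by (intro tendsto_intros tendsto_power_div_exp_0)
  then show ?thesis
    by (simp add: poly_altdef sum_distrib_right exp_minus divide_inverse mult.assoc)
qed

lemma flat_fun_has_vector_derivative:
  "(flat_fun P has_vector_derivative flat_fun ([:0, 0, 1:] * (P - pderiv P)) x) (at x)"
proof -
  let ?Q = "[:0, 0, 1:] * (P - pderiv P)"
  consider "x < 0" | "x = 0" | "x > 0" by linarith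
  then show ?thesis
  proof cases
    case 1
    have "((\<lambda>_. 0) has_vector_derivative 0) (at x)" by simp
    then have "(flat_fun P has_vector_derivative 0) (at x)"
      by (rule has_vector_derivative_transform_within_open[of _ _ _ "{..<0}"])
        (use 1 in \<open>auto simp: flat_fun_def\<close>)
    with 1 show ?thesis by (simp add: flat_fun_def)
  next
    case 2
    have "(((\<lambda>y. poly ([:0,1:] * P) y * exp (- y)) \<circ> (\<lambda>y::real. inverse y)) \<longlongrightarrow> 0) (at_right 0)"
      unfolding o_def
      by (rule filterlim_compose[OF poly_exp_tendsto_0 filterlim_inverse_at_top_right])
    then have "((\<lambda>y. complex_of_real (poly ([:0,1:] * P) (inverse y) * exp (- inverse y))) \<longlongrightarrow> of_real 0)
        (at_right 0)"
      unfolding o_def by (rule tendsto_of_real)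
    then have R: "((\<lambda>y. (flat_fun P y - flat_fun P 0) /\<^sub>R (y - 0)) \<longlongrightarrow> 0) (at_right 0)"
      unfolding of_real_0
      by (rule Lim_transform_eventually)
        (auto simp: eventually_at_filter flat_fun_def scaleR_conv_of_real field_simps)
    have L: "((\<lambda>y. (flat_fun P y - flat_fun P 0) /\<^sub>R (y - 0)) \<longlongrightarrow> 0) (at_left 0)"
      by (rule tendsto_eventually) (auto simp: eventually_at_filter flat_fun_def)
    from L R have "((\<lambda>y. (flat_fun P y - flat_fun P 0) /\<^sub>R (y - 0)) \<longlongrightarrow> 0) (at 0)"
      by (simp add: filterlim_at_split)
    from tendsto_norm_zero[OF this]
    have "((\<lambda>y. norm (flat_fun P y) / \<bar>y\<bar>) \<longlongrightarrow> 0) (at 0)"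
      by (simp add: flat_fun_def[of P 0] divide_inverse mult.commute)
    then show ?thesis
      using 2 by (simp add: has_vector_derivative_def has_derivative_iff_norm flat_fun_def[of _ 0] bounded_linear_zero)
  next
    case 3
    have "((\<lambda>x. poly P (1 / x) * exp (- (1 / x))) has_real_derivative
        poly ?Q (1 / x) * exp (- (1 / x))) (at x)"
      using 3 by (auto intro!: derivative_eq_intros simp: field_simps power2_eq_square)
    then have "((\<lambda>x. complex_of_real (poly P (1 / x) * exp (- (1 / x)))) has_vector_derivative
        of_real (poly ?Q (1 / x) * exp (- (1 / x)))) (at x)"
      by (rule has_vector_derivative_of_real)
    then have "(flat_fun P has_vector_derivative of_real (poly ?Q (1 / x) * exp (- (1 / x)))) (at x)"
      by (rule has_vector_derivative_transform_within_open[of _ _ _ "{0<..}"])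
        (use 3 in \<open>auto simp: flat_fun_def\<close>)
    with 3 show ?thesis by (simp add: flat_fun_def)
  qed
qed

lemma smooth_flat_fun: "smooth (flat_fun P)"
  by (rule smooth_coinduct[of "\<lambda>f. \<exists>P. f = flat_fun P"]) (use flat_fun_has_vector_derivative in blast)+

text \<open>
  The cutoff is specified by a choice operator, so its properties depend on the existence of one
  such function. With \<open>f(x) = e\<^bsup>-1/x\<^esup>\<close> for \<open>x > 0\<close> and \<open>f(x) = 0\<close> otherwise, the quotient
  \<open>f(x + 2) / (f(x + 2) + f(-1 - x))\<close> is one: its denominator never vanishes.
\<close>
lemma cutoff_props: "smooth cutoff \<and> (\<forall>x\<ge>-1. cutoff x = 1) \<and> (\<forall>x\<le>-2. cutoff x = 0)"
proof -
  define f where "f = flat_fun 1"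
  have f: "smooth f" unfolding f_def by (rule smooth_flat_fun)
  have Re: "Re (f x) \<ge> 0" and pos: "Re (f x) > 0 \<longleftrightarrow> x > 0" and zero: "x \<le> 0 \<Longrightarrow> f x = 0" for x
    by (auto simp: f_def flat_fun_def)
  have s1: "smooth (\<lambda>x. f (x + 2))"
    using smooth_reflect[OF smooth_reflect[OF f, of 0], of "-2"] by (simp add: add.commute)
  have s2: "smooth (\<lambda>x. f (-1 - x))" by (rule smooth_reflect[OF f])
  have nz: "f (x + 2) + f (-1 - x) \<noteq> 0" for x
  proof -
    have "Re (f (x + 2)) > 0 \<or> Re (f (-1 - x)) > 0" unfolding pos by linarith
    then have "Re (f (x + 2) + f (-1 - x)) > 0"
      using Re[of "x + 2"] Re[of "-1 - x"] by (auto intro: add_pos_nonneg add_nonneg_pos)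
    then show ?thesis by force
  qed
  have "smooth (\<lambda>x. f (x + 2) / (f (x + 2) + f (-1 - x)))"
    by (intro smooth_divide smooth_add s1 s2 nz)
  moreover have "f (x + 2) / (f (x + 2) + f (-1 - x)) = 1" if "x \<ge> -1" for x
    using nz[of x] zero[of "-1 - x"] that by simp
  ultimately have "\<exists>\<theta>. smooth \<theta> \<and> (\<forall>x\<ge>-1. \<theta> x = 1) \<and> (\<forall>x\<le>-2. \<theta> x = 0)"
    by (intro exI[of _ "\<lambda>x. f (x + 2) / (f (x + 2) + f (-1 - x))"]) (auto simp: zero)
  then show ?thesis unfolding cutoff_def by (rule someI_ex)
qed

section \<open>Distributions and their regularizations\<close>

lemma smooth_fn: "smooth (fn \<phi>)"
  using fn[of \<phi>] by auto

lemma fn_deriv_iterate: "fn ((deriv_test ^^ j) \<phi>) = (vd ^^ j) (fn \<phi>)"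
  by (induction j) (auto simp: deriv_test.rep_eq)

lemma test_fun_eqI: "(\<And>x. fn \<phi> x = fn \<psi> x) \<Longrightarrow> \<phi> = \<psi>"
  by (metis ext fn_inject)

lemma fn_bounded_support:
  obtains L where "L > 0" "\<And>x. \<bar>x\<bar> \<ge> L \<Longrightarrow> fn \<phi> x = 0"
proof -
  have "bounded {x. fn \<phi> x \<noteq> 0}"
    using fn[of \<phi>] by (simp add: compact_closure)
  then obtain L where "\<And>x. fn \<phi> x \<noteq> 0 \<Longrightarrow> \<bar>x\<bar> \<le> L"
    unfolding bounded_iff by auto
  then have "\<bar>x\<bar> \<ge> max L 0 + 1 \<Longrightarrow> fn \<phi> x = 0" for x by fastforce
  then show ?thesis by (intro that[of "max L 0 + 1"]) auto
qed

lemma fn_Abs_test_fun: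
  assumes "smooth f" "\<And>x. \<bar>x\<bar> > L \<Longrightarrow> f x = 0"
  shows "fn (Abs_test_fun f) = f"
proof -
  have "bounded {x. f x \<noteq> 0}"
    unfolding bounded_iff using assms(2) by (intro exI[of _ L]) force
  then show ?thesis
    using assms(1) by (intro Abs_test_fun_inverse) (simp add: compact_closure)
qed

lemma vd_eq_0_outside:
  assumes "open A" "x \<in> A" "\<And>x. x \<in> A \<Longrightarrow> f x = 0"
  shows "vd f x = 0"
proof -
  have "((\<lambda>_. 0) has_vector_derivative 0) (at x)" by simp
  then have "(f has_vector_derivative 0) (at x)"
    by (rule has_vector_derivative_transform_within_open[of _ _ _ A]) (use assms in auto)
  then show ?thesis by (simp add: vd_def vector_derivative_at)
qed

lemma bounded_fn_derivative: "bounded (range ((vd ^^ j) (fn \<phi>)))"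
proof -
  let ?\<psi> = "(deriv_test ^^ j) \<phi>"
  obtain L where L: "L > 0" "\<And>x. \<bar>x\<bar> \<ge> L \<Longrightarrow> fn ?\<psi> x = 0"
    using fn_bounded_support[of ?\<psi>] by blast
  have "compact (fn ?\<psi> ` {-L..L})"
    by (intro compact_continuous_image smooth_continuous_on smooth_fn) simp
  then have "bounded (insert 0 (fn ?\<psi> ` {-L..L}))" by (simp add: compact_imp_bounded)
  moreover have "range (fn ?\<psi>) \<subseteq> insert 0 (fn ?\<psi> ` {-L..L})"
  proof safe
    fix x assume "fn ?\<psi> x \<notin> fn ?\<psi> ` {-L..L}"
    then have "x \<notin> {-L..L}" by blast
    then show "fn ?\<psi> x = 0" using L(2)[of x] by auto
  qed
  ultimately show ?thesis unfolding fn_deriv_iterate using bounded_subset by blast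
qed

lemma fn_derivative_bound: obtains M where "M \<ge> 0" "\<And>j x. j \<le> N \<Longrightarrow> cmod ((vd ^^ j) (fn \<phi>) x) \<le> M"
proof -
  have "\<forall>j. \<exists>M. \<forall>x. cmod ((vd ^^ j) (fn \<phi>) x) \<le> M"
    using bounded_fn_derivative unfolding bounded_iff by blast
  then obtain M where M: "\<And>j x. cmod ((vd ^^ j) (fn \<phi>) x) \<le> M j" by metis
  have nonneg: "0 \<le> M j" for j using M[of j 0] norm_ge_zero order_trans by blast
  have "cmod ((vd ^^ j) (fn \<phi>) x) \<le> sum M {..N}" if "j \<le> N" for j x
    using M[of j x] member_le_sum[of j "{..N}" M] that nonneg by fastforce
  then show ?thesis using that[of "sum M {..N}"] nonneg by (simp add: sum_nonneg)
qed

lemma distribution_add: "T \<in> distributions \<Longrightarrow> T (\<phi> + \<psi>) = T \<phi> + T \<psi>"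
  by (simp add: distributions_def)

lemma distribution_scale: "T \<in> distributions \<Longrightarrow> T (scale_test c \<phi>) = c * T \<phi>"
  by (simp add: distributions_def)

lemma distributions_plus_distributions: "T \<in> distributions_plus \<Longrightarrow> T \<in> distributions"
  by (simp add: distributions_plus_def)

text \<open>
  The continuity of a distribution in a form that is easy to apply: instead of a sum of suprema,
  one common bound \<open>M\<close> for finitely many derivatives.
\<close>
lemma distribution_bound:
  assumes T: "T \<in> distributions"
  obtains C N where "C \<ge> 0" "\<And>\<phi> M. (\<And>x. \<bar>x\<bar> > L \<Longrightarrow> fn \<phi> x = 0) \<Longrightarrow>
    (\<And>j x. j \<le> N \<Longrightarrow> cmod ((vd ^^ j) (fn \<phi>) x) \<le> M) \<Longrightarrow> cmod (T \<phi>) \<le> C * M"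
proof -
  obtain C N where C: "\<And>\<phi>. closure {x. fn \<phi> x \<noteq> 0} \<subseteq> {-L..L} \<Longrightarrow>
      cmod (T \<phi>) \<le> C * (\<Sum>j\<le>N. SUP x. cmod ((vd ^^ j) (fn \<phi>) x))"
    using T compact_Icc[of "-L" L] unfolding distributions_def by blast
  have "cmod (T \<phi>) \<le> (\<bar>C\<bar> * (real N + 1)) * M"
    if supp: "\<And>x. \<bar>x\<bar> > L \<Longrightarrow> fn \<phi> x = 0"
      and M: "\<And>j x. j \<le> N \<Longrightarrow> cmod ((vd ^^ j) (fn \<phi>) x) \<le> M" for \<phi> M
  proof -
    have "x \<in> {-L..L}" if "fn \<phi> x \<noteq> 0" for x
      using supp[of x] that by (cases "\<bar>x\<bar> > L") auto
    then have "closure {x. fn \<phi> x \<noteq> 0} \<subseteq> {-L..L}"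
      by (intro closure_minimal) auto
    then have "cmod (T \<phi>) \<le> C * (\<Sum>j\<le>N. SUP x. cmod ((vd ^^ j) (fn \<phi>) x))" by (rule C)
    also have "\<dots> \<le> \<bar>C\<bar> * (\<Sum>j\<le>N. SUP x. cmod ((vd ^^ j) (fn \<phi>) x))"
    proof (intro mult_right_mono sum_nonneg)
      fix j show "0 \<le> (SUP x. cmod ((vd ^^ j) (fn \<phi>) x))"
        using bounded_fn_derivative[of j \<phi>]
        by (intro cSUP_upper2[where x = 0]) (auto simp: bounded_iff bdd_above_def)
    qed auto
    also have "\<dots> \<le> \<bar>C\<bar> * (\<Sum>j\<le>N. M)"
      by (intro mult_left_mono sum_mono cSUP_least) (auto simp: M)
    finally show ?thesis by (simp add: algebra_simps)
  qed
  then show ?thesis using that[of "\<bar>C\<bar> * (real N + 1)" N] by simp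
qed

lemma distributionsI:
  assumes add: "\<And>\<phi> \<psi>. T (\<phi> + \<psi>) = T \<phi> + T \<psi>"
    and scale: "\<And>c \<phi>. T (scale_test c \<phi>) = c * T \<phi>"
    and bound: "\<And>L. L > 0 \<Longrightarrow> \<exists>C N. C \<ge> 0 \<and> (\<forall>\<phi> M. (\<forall>x. \<bar>x\<bar> > L \<longrightarrow> fn \<phi> x = 0) \<longrightarrow>
      (\<forall>j\<le>N. \<forall>x. cmod ((vd ^^ j) (fn \<phi>) x) \<le> M) \<longrightarrow> cmod (T \<phi>) \<le> C * M)"
  shows "T \<in> distributions"
proof -
  have "\<exists>C N. \<forall>\<phi>. closure {x. fn \<phi> x \<noteq> 0} \<subseteq> K \<longrightarrow>
      cmod (T \<phi>) \<le> C * (\<Sum>j\<le>N. SUP x. cmod ((vd ^^ j) (fn \<phi>) x))" if K: "compact K" for K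
  proof -
    obtain L where L: "L > 0" "\<And>x. x \<in> K \<Longrightarrow> \<bar>x\<bar> \<le> L"
      using compact_imp_bounded[OF K] bounded_pos[of K] by (auto simp: real_norm_def)
    obtain C N where C: "\<And>\<phi> M. (\<forall>x. \<bar>x\<bar> > L \<longrightarrow> fn \<phi> x = 0) \<Longrightarrow>
      (\<forall>j\<le>N. \<forall>x. cmod ((vd ^^ j) (fn \<phi>) x) \<le> M) \<Longrightarrow> cmod (T \<phi>) \<le> C * M"
      using bound[OF L(1)] by blast
    have "cmod (T \<phi>) \<le> C * (\<Sum>j\<le>N. SUP x. cmod ((vd ^^ j) (fn \<phi>) x))"
      if supp: "closure {x. fn \<phi> x \<noteq> 0} \<subseteq> K" for \<phi>
    proof (rule C)
      show "\<forall>x. \<bar>x\<bar> > L \<longrightarrow> fn \<phi> x = 0"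
        using supp L(2) closure_subset[of "{x. fn \<phi> x \<noteq> 0}"] by force
      have bdd: "bdd_above (range (\<lambda>x. cmod ((vd ^^ j) (fn \<phi>) x)))" for j
        using bounded_fn_derivative[of j \<phi>] by (auto simp: bounded_iff bdd_above_def)
      have upper: "cmod ((vd ^^ j) (fn \<phi>) x) \<le> (SUP x. cmod ((vd ^^ j) (fn \<phi>) x))" for j x
        by (rule cSUP_upper[OF _ bdd]) simp
      then have "0 \<le> (SUP x. cmod ((vd ^^ j) (fn \<phi>) x))" for j
        using norm_ge_zero order_trans by blast
      then have "(SUP x. cmod ((vd ^^ j) (fn \<phi>) x)) \<le> (\<Sum>j\<le>N. SUP x. cmod ((vd ^^ j) (fn \<phi>) x))"
        if "j \<le> N" for j
        using that by (intro member_le_sum) auto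
      then show "\<forall>j\<le>N. \<forall>x. cmod ((vd ^^ j) (fn \<phi>) x) \<le> (\<Sum>j\<le>N. SUP x. cmod ((vd ^^ j) (fn \<phi>) x))"
        using upper order_trans by blast
    qed
    then show ?thesis by blast
  qed
  then show ?thesis using add scale by (simp add: distributions_def)
qed

text \<open>
  The mean value inequality, applied to \<open>f'\<close> and then to \<open>f(y) - y f'(x)\<close>, bounds the Taylor remainder
  of first order. Only the order \<open>h\<^sup>2\<close> matters below, so the factor \<open>1/2\<close> is given away.
\<close>
lemma taylor_remainder_bound:
  assumes f: "smooth f" and M: "\<And>x. cmod (vd (vd f) x) \<le> M"
  shows "cmod (f (x + h) - f x - of_real h * vd f x) \<le> M * h\<^sup>2"
proof -
  let ?S = "closed_segment x (x + h)"
  have lip: "cmod (vd f y - vd f x) \<le> M * \<bar>h\<bar>" if "y \<in> ?S" for y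
  proof -
    have "norm (vd f y - vd f x) \<le> M * norm (y - x)"
    proof (rule differentiable_bound[of UNIV "vd f" "\<lambda>z h. h *\<^sub>R vd (vd f) z"])
        fix z
        show "(vd f has_derivative (\<lambda>h. h *\<^sub>R vd (vd f) z)) (at z within UNIV)"
          using smooth_has_vector_derivative[OF smooth_vd[OF f], of z]
          by (simp add: has_vector_derivative_def)
        show "onorm (\<lambda>h. h *\<^sub>R vd (vd f) z) \<le> M"
          using M[of z] by (simp add: onorm_scaleR_left[OF bounded_linear_ident] onorm_id)
      qed auto
    moreover have "norm (y - x) \<le> \<bar>h\<bar>"
      using segment_bound(1)[OF that] by simp
    moreover have "0 \<le> M"
      using M[of 0] norm_ge_zero order_trans by blast
    ultimately show ?thesis
      using mult_left_mono[of "norm (y - x)" "\<bar>h\<bar>" M] by (simp add: mult.commute)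
  qed
  have "cmod (f (x + h) - f x - (x + h - x) *\<^sub>R vd f x) \<le> norm (x + h - x) * (M * \<bar>h\<bar>)"
    by (rule vector_differentiable_bound_linearization[where S="?S"])
      (auto intro: has_vector_derivative_at_within smooth_has_vector_derivative f lip)
  then show ?thesis by (simp add: scaleR_conv_of_real power2_eq_square algebra_simps)
qed

lemma fn_reflect_derivative:
  "(vd ^^ j) (fn (reflect_test x \<phi>)) = (\<lambda>y. (-1) ^ j * (vd ^^ j) (fn \<phi>) (x - y))"
  using vd_iterate_reflect[OF smooth_fn, of j \<phi> x] by (simp add: reflect_test.rep_eq)

text \<open>
  The difference quotients of \<open>x \<mapsto> \<phi>(x - y)\<close> converge to \<open>\<phi>'(x - y)\<close> together with all derivatives
  in \<open>y\<close>, with supports in a fixed compact set. Continuity of the distribution then allows to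
  differentiate under the pairing.
\<close>
lemma dist_conv_test_has_vector_derivative:
  assumes T: "T \<in> distributions"
  shows "(dist_conv_test T \<phi> has_vector_derivative dist_conv_test T (deriv_test \<phi>) x) (at x)"
proof -
  define \<rho> where "\<rho> h = reflect_test (x + h) \<phi> +
    (scale_test (-1) (reflect_test x \<phi>) + scale_test (- of_real h) (reflect_test x (deriv_test \<phi>)))" for h
  obtain R where R: "R > 0" "\<And>x. \<bar>x\<bar> \<ge> R \<Longrightarrow> fn \<phi> x = 0"
    using fn_bounded_support[of \<phi>] by blast
  have R': "vd (fn \<phi>) x = 0" if "\<bar>x\<bar> > R" for x
    by (rule vd_eq_0_outside[of "{..< -R} \<union> {R<..}"]) (use that R(2) in auto)
  obtain C N where C: "C \<ge> 0" "\<And>\<phi> M. (\<And>y. \<bar>y\<bar> > \<bar>x\<bar> + 1 + R \<Longrightarrow> fn \<phi> y = 0) \<Longrightarrow>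
    (\<And>j x. j \<le> N \<Longrightarrow> cmod ((vd ^^ j) (fn \<phi>) x) \<le> M) \<Longrightarrow> cmod (T \<phi>) \<le> C * M"
    using distribution_bound[OF T] by blast
  obtain M where M: "M \<ge> 0" "\<And>j x. j \<le> N + 2 \<Longrightarrow> cmod ((vd ^^ j) (fn \<phi>) x) \<le> M"
    using fn_derivative_bound by blast
  have \<rho>: "(vd ^^ j) (fn (\<rho> h)) y = (-1) ^ j * ((vd ^^ j) (fn \<phi>) (x - y + h) - (vd ^^ j) (fn \<phi>) (x - y)
      - of_real h * vd ((vd ^^ j) (fn \<phi>)) (x - y))" for j h y
  proof -
    have "(vd ^^ j) (fn (\<rho> h)) y = (vd ^^ j) (fn (reflect_test (x + h) \<phi>)) y +
      (-1 * (vd ^^ j) (fn (reflect_test x \<phi>)) y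
        + - of_real h * (vd ^^ j) (fn (reflect_test x (deriv_test \<phi>))) y)"
      by (simp only: \<rho>_def plus_test_fun.rep_eq scale_test.rep_eq vd_iterate_add vd_iterate_cmult
          smooth_add smooth_cmult smooth_fn)
    then show ?thesis
      by (simp add: fn_reflect_derivative deriv_test.rep_eq vd_iterate_vd algebra_simps
        del: funpow.simps) (simp add: algebra_simps)
  qed
  have bound: "cmod (dist_conv_test T \<phi> (x + h) - dist_conv_test T \<phi> x
      - of_real h * dist_conv_test T (deriv_test \<phi>) x) \<le> C * M * h\<^sup>2" if h: "\<bar>h\<bar> \<le> 1" for h
  proof -
    have "cmod (T (\<rho> h)) \<le> C * (M * h\<^sup>2)"
    proof (rule C(2))
      fix y assume y: "\<bar>y\<bar> > \<bar>x\<bar> + 1 + R"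
      have "fn \<phi> (x + h - y) = 0" "fn \<phi> (x - y) = 0" "vd (fn \<phi>) (x - y) = 0"
        using y h R(2)[of "x + h - y"] R(2)[of "x - y"] R'[of "x - y"] by auto
      then show "fn (\<rho> h) y = 0"
        by (simp add: \<rho>_def plus_test_fun.rep_eq scale_test.rep_eq reflect_test.rep_eq deriv_test.rep_eq)
    next
      fix j y assume "j \<le> N"
      then have "cmod (vd (vd ((vd ^^ j) (fn \<phi>))) z) \<le> M" for z
        using M(2)[of "Suc (Suc j)" z] by simp
      from taylor_remainder_bound[OF smooth_iterate[OF smooth_fn] this]
      show "cmod ((vd ^^ j) (fn (\<rho> h)) y) \<le> M * h\<^sup>2"
        by (simp add: \<rho> norm_mult norm_power)
    qed
    moreover have "T (\<rho> h) = dist_conv_test T \<phi> (x + h) - dist_conv_test T \<phi> x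
      - of_real h * dist_conv_test T (deriv_test \<phi>) x"
      by (simp add: \<rho>_def distribution_add[OF T] distribution_scale[OF T] dist_conv_test_def)
    ultimately show ?thesis by (simp add: mult.assoc)
  qed
  have "((\<lambda>h. norm (dist_conv_test T \<phi> (x + h) - dist_conv_test T \<phi> x
      - of_real h * dist_conv_test T (deriv_test \<phi>) x) / \<bar>h\<bar>) \<longlongrightarrow> 0) (at 0)"
  proof (rule tendsto_sandwich[of "\<lambda>_. 0"])
    show "\<forall>\<^sub>F h in at 0. norm (dist_conv_test T \<phi> (x + h) - dist_conv_test T \<phi> x
      - of_real h * dist_conv_test T (deriv_test \<phi>) x) / \<bar>h\<bar> \<le> C * M * \<bar>h\<bar>"
      unfolding eventually_at
    proof (intro exI[of _ 1] conjI ballI impI)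
      fix h :: real assume "h \<noteq> 0 \<and> dist h 0 < 1"
      then show "norm (dist_conv_test T \<phi> (x + h) - dist_conv_test T \<phi> x
      - of_real h * dist_conv_test T (deriv_test \<phi>) x) / \<bar>h\<bar> \<le> C * M * \<bar>h\<bar>"
        using bound[of h] by (simp add: dist_real_def divide_le_eq power2_eq_square algebra_simps)
    qed simp
    have "((\<lambda>h. C * M * \<bar>h\<bar>) \<longlongrightarrow> C * M * \<bar>0\<bar>) (at (0::real))" by (intro tendsto_intros)
    then show "((\<lambda>h. C * M * \<bar>h\<bar>) \<longlongrightarrow> 0) (at (0::real))" by simp
  qed auto
  then show ?thesis
    using bounded_linear_scaleR_left[of "dist_conv_test T (deriv_test \<phi>) x"]
    by (simp add: has_vector_derivative_def has_derivative_at scaleR_conv_of_real)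
qed

lemma vd_dist_conv_test:
  "T \<in> distributions \<Longrightarrow> vd (dist_conv_test T \<phi>) = dist_conv_test T (deriv_test \<phi>)"
  by (rule vd_eqI) (rule dist_conv_test_has_vector_derivative)

lemma vd_iterate_dist_conv_test:
  "T \<in> distributions \<Longrightarrow> (vd ^^ j) (dist_conv_test T \<phi>) = dist_conv_test T ((deriv_test ^^ j) \<phi>)"
  by (induction j) (auto simp: vd_dist_conv_test)

lemma smooth_dist_conv_test: "T \<in> distributions \<Longrightarrow> smooth (dist_conv_test T \<phi>)"
  by (rule smooth_coinduct[of "\<lambda>f. \<exists>\<phi>. f = dist_conv_test T \<phi>"])
    (use dist_conv_test_has_vector_derivative in blast)+

lemma deriv_reflect_test: "deriv_test (reflect_test x \<phi>) = scale_test (-1) (reflect_test x (deriv_test \<phi>))"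
  by (rule test_fun_eqI)
    (simp add: deriv_test.rep_eq reflect_test.rep_eq scale_test.rep_eq vd_reflect smooth_differentiable smooth_fn)

lemma dist_conv_test_dist_deriv:
  assumes "T \<in> distributions"
  shows "dist_conv_test (dist_deriv T) \<phi> = vd (dist_conv_test T \<phi>)"
  unfolding vd_dist_conv_test[OF assms]
  by (simp add: assms fun_eq_iff dist_conv_test_def dist_deriv_def deriv_reflect_test distribution_scale)

lemma dist_conv_test_reflect: "dist_conv_test T (reflect_test 0 \<phi>) 0 = T \<phi>"
proof -
  have "reflect_test 0 (reflect_test 0 \<phi>) = \<phi>"
    by (rule test_fun_eqI) (simp add: reflect_test.rep_eq)
  then show ?thesis by (simp add: dist_conv_test_def)
qed

lemma distribution_plus_eq_0:
  assumes T: "T \<in> distributions_plus" and \<phi>: "\<And>x. x > - e \<Longrightarrow> fn \<phi> x = 0" and "e > 0"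
  shows "T \<phi> = 0"
proof -
  have "x \<in> {..-e}" if "fn \<phi> x \<noteq> 0" for x
    using \<phi>[of x] that by (cases "x > - e") auto
  then have "closure {x. fn \<phi> x \<noteq> 0} \<subseteq> {..-e}" by (intro closure_minimal) auto
  then have "closure {x. fn \<phi> x \<noteq> 0} \<subseteq> {..<0}" using \<open>e > 0\<close> by auto
  then show ?thesis using T by (simp add: distributions_plus_def vanishes_on_def)
qed

text \<open>
  The support of \<open>y \<mapsto> \<phi>(x - y)\<close> lies in \<open>[x - R, x + R]\<close>, hence in the negative half-line if
  \<open>x < -R\<close>. This is the only way in which the support condition on distributions enters the proof of
  uniqueness: it supplies a point at which solutions vanish.
\<close>
lemma dist_conv_test_plus_eq_0:
  assumes T: "T \<in> distributions_plus" and \<phi>: "\<And>x. \<bar>x\<bar> > R \<Longrightarrow> fn \<phi> x = 0" and x: "x < - R"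
  shows "dist_conv_test T \<phi> x = 0"
  unfolding dist_conv_test_def
proof (rule distribution_plus_eq_0[OF T, of "- R - x"])
  fix y assume "y > - (- R - x)"
  then show "fn (reflect_test x \<phi>) y = 0"
    using \<phi>[of "x - y"] by (simp add: reflect_test.rep_eq)
qed (use x in auto)

section \<open>The Green function of a first order operator\<close>

definition green_density :: "real \<Rightarrow> real \<Rightarrow> real \<Rightarrow> complex" where
  "green_density a b t = of_real (1 / a * heaviside t * exp (- (b / a) * t))"

abbreviation green :: "real \<Rightarrow> real \<Rightarrow> test_fun \<Rightarrow> complex" where
  "green a b \<equiv> regular_dist (green_density a b)"

lemma green_density_indicator:
  assumes "\<And>t. t \<ge> L \<Longrightarrow> h t = 0"
  shows "green_density a b t * h t =
    indicator {0..max 0 L} t *\<^sub>R (of_real (1 / a * exp (- (b / a) * t)) * h t)"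
  using assms by (auto simp: green_density_def heaviside_def indicator_def)

lemma integrable_green_density:
  assumes "continuous_on UNIV h" and "\<And>t. t \<ge> L \<Longrightarrow> h t = 0"
  shows "integrable lborel (\<lambda>t. green_density a b t * h t)"
proof -
  have "integrable lborel (\<lambda>t. indicator {0..max 0 L} t *\<^sub>R (of_real (1 / a * exp (- (b / a) * t)) * h t))"
    by (intro borel_integrable_compact continuous_intros continuous_on_subset[OF assms(1)]) auto
  then show ?thesis
    by (subst green_density_indicator[where L = L]) (use assms(2) in auto)
qed

lemma green_density_bound:
  assumes "continuous_on UNIV h" and "\<And>t. t \<ge> L \<Longrightarrow> h t = 0" and "L \<ge> 0"
    and B: "\<And>t. 0 \<le> t \<Longrightarrow> t \<le> L \<Longrightarrow> cmod (h t) \<le> B"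
  shows "cmod (LINT t|lborel. green_density a b t * h t) \<le> L * (\<bar>1 / a\<bar> * exp (\<bar>b / a\<bar> * L)) * B"
proof -
  let ?c = "\<bar>1 / a\<bar> * exp (\<bar>b / a\<bar> * L)"
  have B0: "B \<ge> 0" using B[of 0] \<open>L \<ge> 0\<close> norm_ge_zero order_trans by blast
  have "cmod (LINT t|lborel. green_density a b t * h t) \<le>
      (LINT t|lborel. indicator {0..L} t *\<^sub>R (?c * B))"
  proof (rule Bochner_Integration.integral_norm_bound_integral)
    show "integrable lborel (\<lambda>t. green_density a b t * h t)"
      by (rule integrable_green_density assms)+
    show "integrable lborel (\<lambda>t::real. indicator {0..L} t *\<^sub>R (?c * B))"
      by (intro borel_integrable_compact continuous_intros) auto
    fix t :: real
    have *: "cmod (of_real (1 / a * exp (- (b / a) * t)) * h t) \<le> ?c * B" if t: "0 \<le> t" "t \<le> L"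
    proof -
      have "- (b / a) * t \<le> \<bar>- (b / a) * t\<bar>" by (rule abs_ge_self)
      also have "\<dots> = \<bar>b / a\<bar> * t" using t by (simp add: abs_mult)
      also have "\<dots> \<le> \<bar>b / a\<bar> * L" using t by (intro mult_left_mono) auto
      finally have "- (b / a) * t \<le> \<bar>b / a\<bar> * L" .
      then have "\<bar>1 / a\<bar> * exp (- (b / a) * t) \<le> ?c" by (intro mult_left_mono) auto
      from mult_mono[OF this B[OF t]] show ?thesis by (simp add: norm_mult norm_divide abs_mult)
    qed
    have "green_density a b t * h t =
        indicator {0..max 0 L} t *\<^sub>R (of_real (1 / a * exp (- (b / a) * t)) * h t)"
      by (rule green_density_indicator) (rule assms(2))
    then show "cmod (green_density a b t * h t) \<le> indicator {0..L} t *\<^sub>R (?c * B)"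
      using * \<open>L \<ge> 0\<close> by (auto simp: indicator_def)
  qed
  also have "\<dots> = L * ?c * B" using \<open>L \<ge> 0\<close> by simp
  finally show ?thesis .
qed

text \<open>
  Integration by parts on \<open>[0, \<infinity>)\<close>: the function \<open>t \<mapsto> e\<^bsup>-(b/a)t\<^esup> h(t)\<close> has derivative
  \<open>e\<^bsup>-(b/a)t\<^esup> (h'(t) - (b/a) h(t))\<close> and vanishes at infinity.
\<close>
lemma green_density_by_parts:
  assumes "a \<noteq> 0" and h: "smooth h" and L: "\<And>t. t \<ge> L \<Longrightarrow> h t = 0"
  shows "of_real b * (LINT t|lborel. green_density a b t * h t)
    - of_real a * (LINT t|lborel. green_density a b t * vd h t) = h 0"
proof -
  define M where "M = max 0 (L + 1)"
  define E where "E t = complex_of_real (exp (- (b / a) * t))" for t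
  define f where "f t = E t * vd h t - of_real (b / a) * E t * h t" for t
  have h0: "h t = 0" if "t \<ge> M" for t using L[of t] that by (auto simp: M_def)
  have dh0: "vd h t = 0" if "t \<ge> M" for t
    by (rule vd_eq_0_outside[of "{L<..}"]) (use that L in \<open>auto simp: M_def\<close>)
  have E': "(E has_vector_derivative - of_real (b / a) * E t) (at t)" for t
    using has_vector_derivative_exp_real[of "- (b / a)" t] by (simp add: E_def[abs_def])
  have "((\<lambda>t. E t * h t) has_vector_derivative f t) (at t within {0..M})" for t
    using has_vector_derivative_at_within[OF
        has_vector_derivative_mult[OF E'[of t] smooth_has_vector_derivative[OF h, of t]], of "{0..M}"]
    by (simp add: f_def)
  moreover have "continuous_on {0..M} f"
    unfolding f_def E_def by (intro continuous_intros smooth_continuous_on smooth_vd h)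
  ultimately have "(LINT t|lborel. indicator {0..M} t *\<^sub>R f t) = E M * h M - E 0 * h 0"
    by (intro integral_FTC_Icc) (auto simp: M_def)
  then have *: "(LINT t|lborel. indicator {0..M} t *\<^sub>R f t) = - h 0"
    by (simp add: h0 E_def)
  have eq: "indicator {0..M} t *\<^sub>R f t =
      of_real a * (green_density a b t * vd h t) - of_real b * (green_density a b t * h t)" for t
    using \<open>a \<noteq> 0\<close> h0[of t] dh0[of t]
    by (cases "t \<ge> M") (auto simp: f_def E_def green_density_def heaviside_def indicator_def field_simps)
  have "integrable lborel (\<lambda>t. green_density a b t * h t)"
    by (rule integrable_green_density[of _ M]) (auto intro: smooth_continuous_on h h0)
  moreover have "integrable lborel (\<lambda>t. green_density a b t * vd h t)"
    by (rule integrable_green_density[of _ M]) (auto intro: smooth_continuous_on smooth_vd h dh0)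
  ultimately show ?thesis using * unfolding eq by (simp add: algebra_simps)
qed

text \<open>
  The function \<open>x \<mapsto> \<langle>S\<^sub>y, \<phi>(x + y)\<rangle>\<close>; the shift by \<open>x\<close> is a composition of two reflections.
\<close>
definition translate_pairing :: "(test_fun \<Rightarrow> complex) \<Rightarrow> test_fun \<Rightarrow> real \<Rightarrow> complex" where
  "translate_pairing S \<phi> x = S (reflect_test (- x) (reflect_test 0 \<phi>))"

lemma fn_translate: "fn (reflect_test (- x) (reflect_test 0 \<phi>)) y = fn \<phi> (x + y)"
  by (simp add: reflect_test.rep_eq add.commute)

lemma vd_iterate_fn_translate:
  "(vd ^^ j) (fn (reflect_test (- x) (reflect_test 0 \<phi>))) y = (vd ^^ j) (fn \<phi>) (x + y)"
  by (simp add: fn_reflect_derivative mult.assoc[symmetric] power_mult_distrib[symmetric] add.commute)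

lemma translate_pairing_eq: "translate_pairing S \<phi> = (\<lambda>x. dist_conv_test S (reflect_test 0 \<phi>) (0 - x))"
  by (simp add: translate_pairing_def[abs_def] dist_conv_test_def)

lemma smooth_translate_pairing: "S \<in> distributions \<Longrightarrow> smooth (translate_pairing S \<phi>)"
  unfolding translate_pairing_eq by (rule smooth_reflect) (rule smooth_dist_conv_test)

lemma vd_translate_pairing:
  assumes S: "S \<in> distributions"
  shows "vd (translate_pairing S \<phi>) = translate_pairing S (deriv_test \<phi>)"
proof -
  have "reflect_test x (scale_test c \<psi>) = scale_test c (reflect_test x \<psi>)" for x c \<psi>
    by (rule test_fun_eqI) (simp add: reflect_test.rep_eq scale_test.rep_eq)
  then have "dist_conv_test S (deriv_test (reflect_test 0 \<phi>)) x =
      - dist_conv_test S (reflect_test 0 (deriv_test \<phi>)) x" for x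
    by (simp add: deriv_reflect_test dist_conv_test_def distribution_scale[OF S])
  moreover have "dist_conv_test S (deriv_test (reflect_test 0 \<phi>)) x =
      vd (dist_conv_test S (reflect_test 0 \<phi>)) x" for x
    by (simp add: vd_dist_conv_test S)
  moreover have "vd (\<lambda>x. dist_conv_test S (reflect_test 0 \<phi>) (0 - x)) =
      (\<lambda>x. - vd (dist_conv_test S (reflect_test 0 \<phi>)) (0 - x))"
    by (intro vd_reflect smooth_differentiable smooth_dist_conv_test S)
  ultimately show ?thesis
    unfolding translate_pairing_eq by simp
qed

lemma translate_pairing_0: "translate_pairing S \<phi> 0 = S \<phi>"
  unfolding translate_pairing_eq using dist_conv_test_reflect by simp

lemma translate_pairing_add:
  "S \<in> distributions \<Longrightarrow> translate_pairing S (\<phi> + \<psi>) x = translate_pairing S \<phi> x + translate_pairing S \<psi> x"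
proof -
  assume S: "S \<in> distributions"
  have "reflect_test (- x) (reflect_test 0 (\<phi> + \<psi>)) =
      reflect_test (- x) (reflect_test 0 \<phi>) + reflect_test (- x) (reflect_test 0 \<psi>)"
    by (rule test_fun_eqI) (simp add: reflect_test.rep_eq plus_test_fun.rep_eq)
  then show ?thesis by (simp add: translate_pairing_def distribution_add[OF S])
qed

lemma translate_pairing_scale:
  "S \<in> distributions \<Longrightarrow> translate_pairing S (scale_test c \<phi>) x = c * translate_pairing S \<phi> x"
proof -
  assume S: "S \<in> distributions"
  have "reflect_test (- x) (reflect_test 0 (scale_test c \<phi>)) =
      scale_test c (reflect_test (- x) (reflect_test 0 \<phi>))"
    by (rule test_fun_eqI) (simp add: reflect_test.rep_eq scale_test.rep_eq)
  then show ?thesis by (simp add: translate_pairing_def distribution_scale[OF S])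
qed

lemma translate_pairing_eq_0:
  assumes "S \<in> distributions_plus" and "\<And>x. x > R \<Longrightarrow> fn \<phi> x = 0" and "x > R"
  shows "translate_pairing S \<phi> x = 0"
  unfolding translate_pairing_def
  by (rule distribution_plus_eq_0[OF assms(1), of "x - R"]) (use assms(2,3) in \<open>auto simp: fn_translate\<close>)

text \<open>
  The cutoff in the definition of the convolution is \<open>1\<close> where the density of the Green function is
  not zero, so it disappears from the pairing.
\<close>
lemma dist_conv_green:
  assumes S: "S \<in> distributions_plus"
  shows "dist_conv (green a b) S \<phi> = (LINT t|lborel. green_density a b t * translate_pairing S \<phi> t)"
proof -
  note S' = distributions_plus_distributions[OF S]
  obtain R where R: "R > 0" "\<And>x. \<bar>x\<bar> \<ge> R \<Longrightarrow> fn \<phi> x = 0"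
    using fn_bounded_support[of \<phi>] by blast
  have c: "smooth cutoff" "\<And>x. x \<ge> -1 \<Longrightarrow> cutoff x = 1" "\<And>x. x \<le> -2 \<Longrightarrow> cutoff x = 0"
    using cutoff_props by auto
  have "fn (Abs_test_fun (\<lambda>x. cutoff x * translate_pairing S \<phi> x)) = (\<lambda>x. cutoff x * translate_pairing S \<phi> x)"
  proof (rule fn_Abs_test_fun)
    show "smooth (\<lambda>x. cutoff x * translate_pairing S \<phi> x)"
      by (intro smooth_mult c smooth_translate_pairing S')
    fix x :: real assume "\<bar>x\<bar> > max 2 R"
    then show "cutoff x * translate_pairing S \<phi> x = 0"
      using c(3)[of x] translate_pairing_eq_0[OF S, of R \<phi> x] R(2) by (cases "x \<le> -2") auto
  qed
  then show ?thesis
    unfolding dist_conv_def regular_dist_def translate_pairing_def[symmetric]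
    by (intro Bochner_Integration.integral_cong) (auto simp: green_density_def heaviside_def c(2))
qed

text \<open>
  The Green function sees \<open>x \<mapsto> \<langle>S\<^sub>y, \<phi>(x + y)\<rangle>\<close> only for \<open>x \<ge> 0\<close>. There the function vanishes beyond the
  support of \<open>\<phi>\<close>, so that only a compact interval contributes and the order of \<open>S\<close> bounds the order of
  the convolution. If the support of \<open>\<phi>\<close> is negative, it has a positive distance from \<open>0\<close>, and the
  function vanishes for all \<open>x \<ge> 0\<close>.
\<close>
lemma dist_conv_green_distributions_plus:
  assumes S: "S \<in> distributions_plus"
  shows "dist_conv (green a b) S \<in> distributions_plus"
proof -
  note S' = distributions_plus_distributions[OF S]
  have cont: "continuous_on UNIV (translate_pairing S \<phi>)" for \<phi>
    by (intro smooth_continuous_on smooth_translate_pairing S')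
  have int: "integrable lborel (\<lambda>t. green_density a b t * translate_pairing S \<phi> t)" for \<phi>
  proof -
    obtain R where R: "R > 0" "\<And>x. \<bar>x\<bar> \<ge> R \<Longrightarrow> fn \<phi> x = 0"
      using fn_bounded_support[of \<phi>] by blast
    show ?thesis
      by (rule integrable_green_density[OF cont, of "R + 1"])
        (use translate_pairing_eq_0[OF S, of R \<phi>] R in auto)
  qed
  have "dist_conv (green a b) S \<in> distributions"
  proof (rule distributionsI)
    fix \<phi> \<psi> show "dist_conv (green a b) S (\<phi> + \<psi>) = dist_conv (green a b) S \<phi> + dist_conv (green a b) S \<psi>"
      using int[of \<phi>] int[of \<psi>] by (simp add: dist_conv_green[OF S] translate_pairing_add[OF S'] distrib_left)
  next
    fix c \<phi> show "dist_conv (green a b) S (scale_test c \<phi>) = c * dist_conv (green a b) S \<phi>"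
      using Bochner_Integration.integral_mult_right_zero[of lborel c "\<lambda>t. green_density a b t * translate_pairing S \<phi> t"]
      by (simp add: dist_conv_green[OF S] translate_pairing_scale[OF S'] mult.left_commute)
  next
    fix L :: real assume L: "L > 0"
    obtain C N where C: "C \<ge> 0" "\<And>\<phi> M. (\<And>x. \<bar>x\<bar> > 2 * L + 1 \<Longrightarrow> fn \<phi> x = 0) \<Longrightarrow>
        (\<And>j x. j \<le> N \<Longrightarrow> cmod ((vd ^^ j) (fn \<phi>) x) \<le> M) \<Longrightarrow> cmod (S \<phi>) \<le> C * M"
      using distribution_bound[OF S'] by blast
    let ?D = "(L + 1) * (\<bar>1 / a\<bar> * exp (\<bar>b / a\<bar> * (L + 1)))"
    have "cmod (dist_conv (green a b) S \<phi>) \<le> ?D * C * M"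
      if supp: "\<forall>x. \<bar>x\<bar> > L \<longrightarrow> fn \<phi> x = 0"
        and M: "\<forall>j\<le>N. \<forall>x. cmod ((vd ^^ j) (fn \<phi>) x) \<le> M" for \<phi> M
    proof -
      have "cmod (translate_pairing S \<phi> t) \<le> C * M" if "0 \<le> t" "t \<le> L + 1" for t
        unfolding translate_pairing_def
        by (rule C(2)) (use that supp M in \<open>auto simp: fn_translate vd_iterate_fn_translate\<close>)
      then have "cmod (LINT t|lborel. green_density a b t * translate_pairing S \<phi> t) \<le> ?D * (C * M)"
        by (intro green_density_bound cont translate_pairing_eq_0[OF S, of L]) (use supp L in auto)
      then show ?thesis by (simp add: dist_conv_green[OF S] mult.assoc)
    qed
    moreover have "0 \<le> ?D * C" using L C(1) by (intro mult_nonneg_nonneg) auto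
    ultimately show "\<exists>C N. C \<ge> 0 \<and> (\<forall>\<phi> M. (\<forall>x. \<bar>x\<bar> > L \<longrightarrow> fn \<phi> x = 0) \<longrightarrow>
      (\<forall>j\<le>N. \<forall>x. cmod ((vd ^^ j) (fn \<phi>) x) \<le> M) \<longrightarrow> cmod (dist_conv (green a b) S \<phi>) \<le> C * M)"
      by blast
  qed
  moreover have "dist_conv (green a b) S \<phi> = 0" if supp: "closure {x. fn \<phi> x \<noteq> 0} \<subseteq> {..<0}" for \<phi>
  proof -
    have "compact (closure {x. fn \<phi> x \<noteq> 0})" using fn[of \<phi>] by simp
    moreover have 0: "fn \<phi> x = 0" if "x \<ge> 0" for x
      using supp closure_subset[of "{x. fn \<phi> x \<noteq> 0}"] that by force
    \<comment> \<open>The support is compact and negative, so its maximum is at most some \<open>-e < 0\<close>.\<close>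
    have "\<exists>e>0. \<forall>x. x > - e \<longrightarrow> fn \<phi> x = 0"
    proof (cases "{x. fn \<phi> x \<noteq> 0} = {}")
      case True then show ?thesis by (intro exI[of _ 1]) auto
    next
      case False
      then obtain m where m: "m \<in> closure {x. fn \<phi> x \<noteq> 0}" "\<And>x. x \<in> closure {x. fn \<phi> x \<noteq> 0} \<Longrightarrow> x \<le> m"
        using compact_attains_sup[OF calculation] by auto
      then show ?thesis
        using supp closure_subset[of "{x. fn \<phi> x \<noteq> 0}"] by (intro exI[of _ "- m"]) fastforce
    qed
    then obtain e where e: "e > 0" "\<And>x. x > - e \<Longrightarrow> fn \<phi> x = 0" by blast
    have "translate_pairing S \<phi> t = 0" if "t \<ge> 0" for t
      by (rule translate_pairing_eq_0[OF S, of "- e"]) (use e that in auto)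
    then have "(\<lambda>t. green_density a b t * translate_pairing S \<phi> t) = (\<lambda>t. 0)"
      by (auto simp: green_density_def heaviside_def)
    then show ?thesis by (simp add: dist_conv_green[OF S])
  qed
  ultimately show ?thesis by (simp add: distributions_plus_def vanishes_on_def)
qed

text \<open>
  Integration by parts applies to \<open>h(x) = \<langle>S\<^sub>y, \<phi>(x + y)\<rangle>\<close>, whose derivative is \<open>\<langle>S\<^sub>y, \<phi>'(x + y)\<rangle>\<close> and whose
  value at \<open>0\<close> is \<open>S(\<phi>)\<close>.
\<close>
lemma dist_conv_green_equation:
  assumes "a \<noteq> 0" and S: "S \<in> distributions_plus"
  shows "of_real a * dist_deriv (dist_conv (green a b) S) \<phi> + of_real b * dist_conv (green a b) S \<phi> = S \<phi>"
proof -
  note S' = distributions_plus_distributions[OF S]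
  obtain R where R: "R > 0" "\<And>x. \<bar>x\<bar> \<ge> R \<Longrightarrow> fn \<phi> x = 0"
    using fn_bounded_support[of \<phi>] by blast
  have "translate_pairing S \<phi> t = 0" if "t \<ge> R + 1" for t
    by (rule translate_pairing_eq_0[OF S, of R]) (use R that in auto)
  from green_density_by_parts[OF assms(1) smooth_translate_pairing[OF S'], of "R + 1" \<phi> b, OF this]
  show ?thesis
    by (simp add: dist_deriv_def dist_conv_green[OF S] vd_translate_pairing[OF S'] translate_pairing_0
        algebra_simps)
qed

lemma dirac_distributions_plus: "dirac \<in> distributions_plus"
proof -
  have "dirac \<in> distributions"
  proof (rule distributionsI)
    show "\<exists>C N. C \<ge> 0 \<and> (\<forall>\<phi> M. (\<forall>x. \<bar>x\<bar> > L \<longrightarrow> fn \<phi> x = 0) \<longrightarrow>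
      (\<forall>j\<le>N. \<forall>x. cmod ((vd ^^ j) (fn \<phi>) x) \<le> M) \<longrightarrow> cmod (dirac \<phi>) \<le> C * M)" for L
      by (intro exI[of _ 1] exI[of _ 0]) (auto simp: dirac_def)
  qed (auto simp: dirac_def plus_test_fun.rep_eq scale_test.rep_eq)
  moreover have "vanishes_on dirac {..<0}"
    unfolding vanishes_on_def dirac_def
  proof (intro allI impI)
    fix \<phi> assume "closure {x. fn \<phi> x \<noteq> 0} \<subseteq> {..<0}"
    then have "0 \<notin> {x. fn \<phi> x \<noteq> 0}" using closure_subset[of "{x. fn \<phi> x \<noteq> 0}"] by auto
    then show "fn \<phi> 0 = 0" by simp
  qed
  ultimately show ?thesis by (simp add: distributions_plus_def)
qed

text \<open>
  Since \<open>\<delta>\<close> is neutral for the convolution, everything that holds for \<open>g \<star> S\<close> holds for \<open>g\<close>; in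
  particular \<open>g\<close> is a distribution, and a fundamental solution.
\<close>
lemma dist_conv_green_dirac: "dist_conv (green a b) dirac = green a b"
  by (rule ext) (simp add: dist_conv_green[OF dirac_distributions_plus] regular_dist_def
      translate_pairing_def dirac_def fn_translate)

text \<open>
  Gronwall's estimate in the linear case: after multiplication by the integrating factor
  \<open>e\<^bsup>(b/a)t\<^esup>\<close>, the mean value inequality bounds a function by its value at one point and the size of
  \<open>a y' + b y\<close>. For nets it turns negligible data into negligible solutions, and with \<open>\<eta> = 0\<close> it is
  the classical uniqueness theorem.
\<close>
lemma linear_ode_estimate:
  assumes "a \<noteq> 0" and y: "smooth y"
    and \<eta>: "\<And>s. \<bar>s\<bar> \<le> L \<Longrightarrow> cmod (of_real a * vd y s + of_real b * y s) \<le> \<eta>"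
    and x0: "\<bar>x0\<bar> \<le> L" and t: "\<bar>t\<bar> \<le> L"
  shows "cmod (y t) \<le> exp (\<bar>b / a\<bar> * L) * exp (\<bar>b / a\<bar> * L) * (1 + 2 * L / \<bar>a\<bar>) * (cmod (y x0) + \<eta>)"
proof -
  let ?k = "b / a" and ?e = "exp (\<bar>b / a\<bar> * L)"
  define w where "w s = complex_of_real (exp (?k * s)) * y s" for s
  define w' where "w' s = complex_of_real (exp (?k * s)) * (vd y s + of_real ?k * y s)" for s
  have \<eta>0: "\<eta> \<ge> 0" using \<eta>[OF t] norm_ge_zero order_trans by blast
  have L: "L \<ge> 0" using t by linarith
  have exp_le: "exp (c * s) \<le> ?e" if "\<bar>s\<bar> \<le> L" "\<bar>c\<bar> = \<bar>?k\<bar>" for c s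
  proof -
    have "c * s \<le> \<bar>c\<bar> * \<bar>s\<bar>" by (metis abs_ge_self abs_mult)
    also have "\<dots> \<le> \<bar>?k\<bar> * L" using that by (intro mult_mono) auto
    finally show ?thesis by simp
  qed
  have w': "(w has_vector_derivative w' s) (at s)" for s
    using has_vector_derivative_mult[OF has_vector_derivative_exp_real[of ?k s] smooth_has_vector_derivative[OF y, of s]]
    by (simp add: w_def[abs_def] w'_def algebra_simps)
  have w'_le: "cmod (w' s) \<le> ?e * (\<eta> / \<bar>a\<bar>)" if "\<bar>s\<bar> \<le> L" for s
  proof -
    have "vd y s + of_real ?k * y s = (of_real a * vd y s + of_real b * y s) / of_real a"
      using \<open>a \<noteq> 0\<close> by (simp add: field_simps)
    then have "cmod (vd y s + of_real ?k * y s) \<le> \<eta> / \<bar>a\<bar>"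
      using \<eta>[OF that] by (simp add: norm_divide divide_right_mono)
    then show ?thesis
      unfolding w'_def norm_mult using exp_le[OF that, of ?k] by (intro mult_mono) auto
  qed
  have "norm (w t - w x0) \<le> ?e * (\<eta> / \<bar>a\<bar>) * norm (t - x0)"
  proof (rule differentiable_bound[of "{-L..L}" w "\<lambda>s h. h *\<^sub>R w' s"])
    fix s assume s: "s \<in> {-L..L}"
    show "(w has_derivative (\<lambda>h. h *\<^sub>R w' s)) (at s within {-L..L})"
      using w'[of s] by (simp add: has_vector_derivative_def has_derivative_at_withinI)
    show "onorm (\<lambda>h. h *\<^sub>R w' s) \<le> ?e * (\<eta> / \<bar>a\<bar>)"
      using w'_le[of s] s by (simp add: onorm_scaleR_left[OF bounded_linear_ident] onorm_id abs_le_iff)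
  qed (use x0 t in \<open>auto simp: abs_le_iff\<close>)
  also have "\<dots> \<le> ?e * (\<eta> / \<bar>a\<bar>) * (2 * L)"
    using x0 t \<eta>0 by (intro mult_left_mono) auto
  finally have "cmod (w t) \<le> cmod (w x0) + ?e * (\<eta> / \<bar>a\<bar>) * (2 * L)"
    using norm_triangle_ineq2[of "w t" "w x0"] by linarith
  moreover have "cmod (w x0) \<le> ?e * cmod (y x0)"
    unfolding w_def norm_mult using exp_le[OF x0, of ?k] by (intro mult_right_mono) auto
  ultimately have wt: "cmod (w t) \<le> ?e * (cmod (y x0) + 2 * L / \<bar>a\<bar> * \<eta>)"
    by (simp add: algebra_simps)
  have "y t = of_real (exp (- ?k * t)) * w t"
    by (simp add: w_def mult.assoc[symmetric] of_real_mult[symmetric] exp_add[symmetric] del: of_real_mult)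
  then have "cmod (y t) \<le> ?e * (?e * (cmod (y x0) + 2 * L / \<bar>a\<bar> * \<eta>))"
    unfolding norm_mult using exp_le[OF t, of "- ?k"] wt by (auto simp: norm_mult intro!: mult_mono)
  also have "\<dots> \<le> ?e * (?e * ((1 + 2 * L / \<bar>a\<bar>) * (cmod (y x0) + \<eta>)))"
  proof (intro mult_left_mono)
    have "0 \<le> 2 * L / \<bar>a\<bar> * cmod (y x0)" using L by simp
    then show "cmod (y x0) + 2 * L / \<bar>a\<bar> * \<eta> \<le> (1 + 2 * L / \<bar>a\<bar>) * (cmod (y x0) + \<eta>)"
      using \<eta>0 by (simp add: distrib_right distrib_left)
  qed auto
  finally show ?thesis by (simp add: mult.assoc)
qed

text \<open>
  Uniqueness: the regularizations \<open>G \<star> \<phi>\<close> of a solution of the homogeneous equation are smooth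
  solutions that vanish far to the left, hence are zero, and \<open>G(\<phi>)\<close> is a value of one of them.
\<close>
lemma homogeneous_solution_vanishing:
  assumes "a \<noteq> 0" and G: "G \<in> distributions_plus"
    and eq: "\<And>\<phi>. of_real a * dist_deriv G \<phi> + of_real b * G \<phi> = 0"
  shows "G \<phi> = 0"
proof -
  note G' = distributions_plus_distributions[OF G]
  let ?v = "dist_conv_test G (reflect_test 0 \<phi>)"
  obtain R where R: "R > 0" "\<And>x. \<bar>x\<bar> \<ge> R \<Longrightarrow> fn (reflect_test 0 \<phi>) x = 0"
    using fn_bounded_support[of "reflect_test 0 \<phi>"] by blast
  have "?v (- R - 1) = 0"
    by (rule dist_conv_test_plus_eq_0[OF G, of R]) (use R in auto)
  moreover have "of_real a * vd ?v s + of_real b * ?v s = 0" for s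
    using eq by (simp add: dist_conv_test_dist_deriv[OF G', symmetric]) (simp add: dist_conv_test_def)
  ultimately have "cmod (?v 0) \<le> 0"
    using linear_ode_estimate[OF \<open>a \<noteq> 0\<close> smooth_dist_conv_test[OF G'],
        where L = "R + 1" and b = b and \<eta> = 0 and ?x0.0 = "- R - 1" and t = 0
          and \<phi>1 = "reflect_test 0 \<phi>"] R(1)
    by auto
  then show ?thesis by (simp add: dist_conv_test_reflect)
qed

lemma poly_diff_op_linear:
  "a \<noteq> 0 \<Longrightarrow> poly_diff_op [:of_real b, of_real a:] T \<phi> = of_real a * dist_deriv T \<phi> + of_real b * T \<phi>"
  by (simp add: poly_diff_op_def)

lemma green_function_eq:
  assumes "a \<noteq> 0"
  shows "green_function [:of_real b, of_real a:] = green a b"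
  unfolding green_function_def
proof (rule the_equality)
  let ?g = "green a b"
  have g: "?g \<in> distributions_plus"
    using dist_conv_green_distributions_plus[OF dirac_distributions_plus, of a b]
    by (simp add: dist_conv_green_dirac)
  have geq: "of_real a * dist_deriv ?g \<phi> + of_real b * ?g \<phi> = dirac \<phi>" for \<phi>
    using dist_conv_green_equation[OF assms dirac_distributions_plus, of b \<phi>]
    by (simp add: dist_conv_green_dirac)
  show "?g \<in> distributions \<and> poly_diff_op [:of_real b, of_real a:] ?g = dirac \<and> vanishes_on ?g {..<0}"
    using g geq assms by (auto simp: distributions_plus_def poly_diff_op_linear)
  fix G assume G: "G \<in> distributions \<and> poly_diff_op [:of_real b, of_real a:] G = dirac \<and> vanishes_on G {..<0}"
  then have Geq: "of_real a * dist_deriv G \<phi> + of_real b * G \<phi> = dirac \<phi>" for \<phi>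
    using assms by (metis poly_diff_op_linear)
  have "(\<lambda>\<phi>. G \<phi> - ?g \<phi>) \<in> distributions_plus"
  proof -
    have "(\<lambda>\<phi>. G \<phi> - ?g \<phi>) \<in> distributions"
    proof (rule distributionsI)
      fix L :: real
      obtain C N where C: "C \<ge> 0" "\<And>\<phi> M. (\<And>x. \<bar>x\<bar> > L \<Longrightarrow> fn \<phi> x = 0) \<Longrightarrow>
        (\<And>j x. j \<le> N \<Longrightarrow> cmod ((vd ^^ j) (fn \<phi>) x) \<le> M) \<Longrightarrow> cmod (G \<phi>) \<le> C * M"
        using distribution_bound[of G L] G by blast
      obtain C' N' where C': "C' \<ge> 0" "\<And>\<phi> M. (\<And>x. \<bar>x\<bar> > L \<Longrightarrow> fn \<phi> x = 0) \<Longrightarrow>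
        (\<And>j x. j \<le> N' \<Longrightarrow> cmod ((vd ^^ j) (fn \<phi>) x) \<le> M) \<Longrightarrow> cmod (?g \<phi>) \<le> C' * M"
        using distribution_bound[OF distributions_plus_distributions[OF g], of L] by blast
      have "cmod (G \<phi> - ?g \<phi>) \<le> (C + C') * M"
        if "\<forall>x. \<bar>x\<bar> > L \<longrightarrow> fn \<phi> x = 0" "\<forall>j\<le>max N N'. \<forall>x. cmod ((vd ^^ j) (fn \<phi>) x) \<le> M" for \<phi> M
        using C(2)[of \<phi> M] C'(2)[of \<phi> M] that norm_triangle_ineq4[of "G \<phi>" "?g \<phi>"]
        by (simp add: distrib_right)
      then show "\<exists>C N. C \<ge> 0 \<and> (\<forall>\<phi> M. (\<forall>x. \<bar>x\<bar> > L \<longrightarrow> fn \<phi> x = 0) \<longrightarrow>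
        (\<forall>j\<le>N. \<forall>x. cmod ((vd ^^ j) (fn \<phi>) x) \<le> M) \<longrightarrow> cmod (G \<phi> - ?g \<phi>) \<le> C * M)"
        using C(1) C'(1) by (intro exI[of _ "C + C'"] exI[of _ "max N N'"]) auto
    qed (use G g in \<open>auto simp: distribution_add distribution_scale distributions_plus_def algebra_simps\<close>)
    then show ?thesis using G g by (auto simp: distributions_plus_def vanishes_on_def)
  qed
  moreover have "of_real a * dist_deriv (\<lambda>\<phi>. G \<phi> - ?g \<phi>) \<phi> + of_real b * (G \<phi> - ?g \<phi>) = 0" for \<phi>
    using Geq[of \<phi>] geq[of \<phi>] by (simp add: dist_deriv_def algebra_simps)
  ultimately have "G \<phi> - ?g \<phi> = 0" for \<phi>
    by (rule homogeneous_solution_vanishing[OF assms])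
  then show "G = ?g" by (simp add: fun_eq_iff)
qed

section \<open>Moderate and negligible nets\<close>

locale mollifier_filter =
  fixes U :: "test_fun filter"
  assumes ev_mollifier: "\<forall>\<^sub>F \<phi> in U. \<phi> \<in> mollifiers n"

lemma fn_eq_0_outside_radius:
  assumes "\<bar>x\<bar> > radius \<phi>"
  shows "fn \<phi> x = 0"
proof (rule ccontr)
  assume nz: "fn \<phi> x \<noteq> 0"
  then have "\<phi> \<noteq> 0" by (auto simp: zero_test_fun.rep_eq)
  obtain L where L: "L > 0" "\<And>x. \<bar>x\<bar> \<ge> L \<Longrightarrow> fn \<phi> x = 0"
    using fn_bounded_support[of \<phi>] by blast
  have "\<bar>x\<bar> \<le> Sup {\<bar>x\<bar> | x. fn \<phi> x \<noteq> 0}"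
  proof (rule cSup_upper)
    show "\<bar>x\<bar> \<in> {\<bar>x\<bar> | x. fn \<phi> x \<noteq> 0}" using nz by blast
    show "bdd_above {\<bar>x\<bar> | x. fn \<phi> x \<noteq> 0}"
      unfolding bdd_above_def using L(2) by (intro exI[of _ L]) (auto intro: linorder_le_cases)
  qed
  with assms \<open>\<phi> \<noteq> 0\<close> show False by (simp add: radius_def)
qed

text \<open>
  A test function that vanishes off the origin has integral \<open>0\<close>, not \<open>1\<close>.
\<close>
lemma mollifier_radius_pos:
  assumes "\<phi> \<in> mollifiers n" "n \<ge> 1"
  shows "radius \<phi> > 0"
proof (rule ccontr)
  assume "\<not> radius \<phi> > 0"
  then have "fn \<phi> x = 0" if "x \<noteq> 0" for x
    using fn_eq_0_outside_radius[of \<phi> x] that by linarith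
  then have "AE x in lborel. fn \<phi> x = 0"
    using AE_lborel_singleton[of "0::real"] by (auto elim: eventually_mono)
  then have "(LINT x|lborel. fn \<phi> x) = 0" by (rule integral_eq_zero_AE)
  with assms show False by (simp add: mollifiers_def)
qed

definition moderate_on :: "test_fun filter \<Rightarrow> real set \<Rightarrow> (test_fun \<Rightarrow> real \<Rightarrow> complex) \<Rightarrow> bool" where
  "moderate_on U K f \<longleftrightarrow> (\<exists>m::nat. \<forall>\<^sub>F \<phi> in U. \<forall>t\<in>K. cmod (f \<phi> t) \<le> 1 / radius \<phi> ^ m)"

definition negligible_on :: "test_fun filter \<Rightarrow> real set \<Rightarrow> (test_fun \<Rightarrow> real \<Rightarrow> complex) \<Rightarrow> bool" where
  "negligible_on U K f \<longleftrightarrow> (\<forall>p::nat. \<forall>\<^sub>F \<phi> in U. \<forall>t\<in>K. cmod (f \<phi> t) \<le> radius \<phi> ^ p)"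

lemma moderate_E_iff: "f \<in> moderate_E U \<longleftrightarrow>
    (\<forall>\<phi>. smooth (f \<phi>)) \<and> (\<forall>K j. compact K \<longrightarrow> moderate_on U K (\<lambda>\<phi>. (vd ^^ j) (f \<phi>)))"
  by (simp add: moderate_E_def moderate_on_def)

lemma negligible_E_iff: "f \<in> negligible_E U \<longleftrightarrow>
    (\<forall>\<phi>. smooth (f \<phi>)) \<and> (\<forall>K j. compact K \<longrightarrow> negligible_on U K (\<lambda>\<phi>. (vd ^^ j) (f \<phi>)))"
  by (simp add: negligible_E_def negligible_on_def)

lemma moderate_C_iff: "A \<in> moderate_C U \<longleftrightarrow> moderate_on U {x} (\<lambda>\<phi> t. A \<phi>)"
  by (simp add: moderate_C_def moderate_on_def)

lemma negligible_C_iff: "A \<in> negligible_C U \<longleftrightarrow> negligible_on U {x} (\<lambda>\<phi> t. A \<phi>)"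
  by (simp add: negligible_C_def negligible_on_def)

lemma moderate_E_derivative_on:
  "f \<in> moderate_E U \<Longrightarrow> compact K \<Longrightarrow> moderate_on U K (\<lambda>\<phi>. (vd ^^ j) (f \<phi>))"
  by (simp add: moderate_E_iff)

lemma moderate_E_on: "f \<in> moderate_E U \<Longrightarrow> compact K \<Longrightarrow> moderate_on U K f"
  using moderate_E_derivative_on[of f U K 0] by simp

lemma negligible_E_derivative_on:
  "f \<in> negligible_E U \<Longrightarrow> compact K \<Longrightarrow> negligible_on U K (\<lambda>\<phi>. (vd ^^ j) (f \<phi>))"
  by (simp add: negligible_E_iff)

lemma negligible_E_on: "f \<in> negligible_E U \<Longrightarrow> compact K \<Longrightarrow> negligible_on U K f"
  using negligible_E_derivative_on[of f U K 0] by simp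

lemma smooth_moderate_E: "f \<in> moderate_E U \<Longrightarrow> smooth (f \<phi>)"
  by (simp add: moderate_E_def)

lemma smooth_negligible_E: "f \<in> negligible_E U \<Longrightarrow> smooth (f \<phi>)"
  by (simp add: negligible_E_def)

lemma vd_moderate_E: "f \<in> moderate_E U \<Longrightarrow> (\<lambda>\<phi>. vd (f \<phi>)) \<in> moderate_E U"
  unfolding moderate_E_iff vd_iterate_vd by (auto intro: smooth_vd simp del: funpow.simps)

lemma vd_negligible_E: "f \<in> negligible_E U \<Longrightarrow> (\<lambda>\<phi>. vd (f \<phi>)) \<in> negligible_E U"
  unfolding negligible_E_iff vd_iterate_vd by (auto intro: smooth_vd simp del: funpow.simps)

lemma value_moderate_E: "f \<in> moderate_E U \<Longrightarrow> (\<lambda>\<phi>. f \<phi> x) \<in> moderate_C U"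
  using moderate_E_on[of f U "{x}"] by (simp add: moderate_on_def moderate_C_def)

lemma value_negligible_E: "f \<in> negligible_E U \<Longrightarrow> (\<lambda>\<phi>. f \<phi> x) \<in> negligible_C U"
  using negligible_E_on[of f U "{x}"] by (simp add: negligible_on_def negligible_C_def)

lemma vd_iterate_const: "(vd ^^ j) (\<lambda>t. c) = (\<lambda>t. if j = 0 then c else 0)"
proof (induction j)
  case (Suc j)
  show ?case unfolding funpow.simps o_def Suc.IH
    by (rule vd_eqI) simp
qed simp

context mollifier_filter
begin

lemma ev_radius_less:
  assumes "e > 0"
  shows "\<forall>\<^sub>F \<phi> in U. 0 < radius \<phi> \<and> radius \<phi> < e"
proof -
  obtain n :: nat where n: "1 / e < real n" using reals_Archimedean2 by blast
  with assms have n1: "n \<ge> 1" by (cases n) (auto simp: divide_less_0_iff)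
  have "1 / real n < e" using n assms n1 by (simp add: field_simps)
  moreover have "radius \<phi> \<le> 1 / real n" if "\<phi> \<in> mollifiers n" for \<phi>
    using that n1 by (simp add: mollifiers_def)
  ultimately show ?thesis
    using mollifier_radius_pos[OF _ n1] by (intro eventually_mono[OF ev_mollifier[of n]]) force
qed

text \<open>
  Since \<open>R\<^sub>\<phi>\<close> tends to \<open>0\<close> along the filter, a constant factor is absorbed by one more power of \<open>R\<^sub>\<phi>\<close>.
\<close>
lemma moderate_onI:
  assumes "\<forall>\<^sub>F \<phi> in U. \<forall>t\<in>K. cmod (f \<phi> t) \<le> C / radius \<phi> ^ m"
  shows "moderate_on U K f"
proof -
  have "0 < 1 / (\<bar>C\<bar> + 1)" by simp
  from assms ev_radius_less[OF this]
  have "\<forall>\<^sub>F \<phi> in U. \<forall>t\<in>K. cmod (f \<phi> t) \<le> 1 / radius \<phi> ^ Suc m"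
  proof eventually_elim
    case (elim \<phi>)
    have "C * radius \<phi> \<le> (\<bar>C\<bar> + 1) * radius \<phi>" using elim(2) by (intro mult_right_mono) auto
    also have "\<dots> \<le> 1" using elim(2) by (simp add: field_simps)
    finally have "C / radius \<phi> ^ m \<le> 1 / radius \<phi> ^ Suc m" using elim(2) by (simp add: field_simps)
    with elim(1) show ?case by fastforce
  qed
  then show ?thesis unfolding moderate_on_def by blast
qed

lemma negligible_onI:
  assumes "\<And>p. \<exists>C. \<forall>\<^sub>F \<phi> in U. \<forall>t\<in>K. cmod (f \<phi> t) \<le> C * radius \<phi> ^ p"
  shows "negligible_on U K f"
  unfolding negligible_on_def
proof
  fix p
  obtain C where C: "\<forall>\<^sub>F \<phi> in U. \<forall>t\<in>K. cmod (f \<phi> t) \<le> C * radius \<phi> ^ Suc p"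
    using assms by blast
  have "0 < 1 / (\<bar>C\<bar> + 1)" by simp
  from C ev_radius_less[OF this]
  show "\<forall>\<^sub>F \<phi> in U. \<forall>t\<in>K. cmod (f \<phi> t) \<le> radius \<phi> ^ p"
  proof eventually_elim
    case (elim \<phi>)
    have "C * radius \<phi> \<le> (\<bar>C\<bar> + 1) * radius \<phi>" using elim(2) by (intro mult_right_mono) auto
    also have "\<dots> \<le> 1" using elim(2) by (simp add: field_simps)
    finally have "(C * radius \<phi>) * radius \<phi> ^ p \<le> 1 * radius \<phi> ^ p"
      using elim(2) by (intro mult_right_mono) auto
    then have "C * radius \<phi> ^ Suc p \<le> radius \<phi> ^ p" by (simp add: mult.assoc)
    with elim(1) show ?case using order_trans by blast
  qed
qed

lemma moderate_on_add:
  assumes "moderate_on U K f" "moderate_on U K g"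
  shows "moderate_on U K (\<lambda>\<phi> t. f \<phi> t + g \<phi> t)"
proof -
  obtain m n where f: "\<forall>\<^sub>F \<phi> in U. \<forall>t\<in>K. cmod (f \<phi> t) \<le> 1 / radius \<phi> ^ m"
    and g: "\<forall>\<^sub>F \<phi> in U. \<forall>t\<in>K. cmod (g \<phi> t) \<le> 1 / radius \<phi> ^ n"
    using assms by (auto simp: moderate_on_def)
  from f g ev_radius_less[OF zero_less_one]
  have "\<forall>\<^sub>F \<phi> in U. \<forall>t\<in>K. cmod (f \<phi> t + g \<phi> t) \<le> 2 / radius \<phi> ^ (m + n)"
  proof eventually_elim
    case (elim \<phi>)
    have le: "1 / radius \<phi> ^ m \<le> 1 / radius \<phi> ^ (m + n)" "1 / radius \<phi> ^ n \<le> 1 / radius \<phi> ^ (m + n)"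
      using elim(3) by (intro divide_left_mono power_decreasing; simp)+
    show ?case
    proof
      fix t assume "t \<in> K"
      then have "cmod (f \<phi> t) + cmod (g \<phi> t) \<le> 1 / radius \<phi> ^ (m + n) + 1 / radius \<phi> ^ (m + n)"
        using elim le by (intro add_mono) (meson order_trans)+
      then show "cmod (f \<phi> t + g \<phi> t) \<le> 2 / radius \<phi> ^ (m + n)"
        using norm_triangle_ineq[of "f \<phi> t" "g \<phi> t"] by simp
    qed
  qed
  then show ?thesis by (rule moderate_onI)
qed

lemma moderate_on_mult:
  assumes "moderate_on U K f" "moderate_on U K g"
  shows "moderate_on U K (\<lambda>\<phi> t. f \<phi> t * g \<phi> t)"
proof -
  obtain m n where f: "\<forall>\<^sub>F \<phi> in U. \<forall>t\<in>K. cmod (f \<phi> t) \<le> 1 / radius \<phi> ^ m"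
    and g: "\<forall>\<^sub>F \<phi> in U. \<forall>t\<in>K. cmod (g \<phi> t) \<le> 1 / radius \<phi> ^ n"
    using assms by (auto simp: moderate_on_def)
  from f g ev_radius_less[OF zero_less_one]
  have "\<forall>\<^sub>F \<phi> in U. \<forall>t\<in>K. cmod (f \<phi> t * g \<phi> t) \<le> 1 / radius \<phi> ^ (m + n)"
  proof eventually_elim
    case (elim \<phi>)
    show ?case
    proof
      fix t assume "t \<in> K"
      then have "cmod (f \<phi> t) * cmod (g \<phi> t) \<le> 1 / radius \<phi> ^ m * (1 / radius \<phi> ^ n)"
        using elim by (intro mult_mono) auto
      then show "cmod (f \<phi> t * g \<phi> t) \<le> 1 / radius \<phi> ^ (m + n)"
        by (simp add: norm_mult power_add)
    qed
  qed
  then show ?thesis unfolding moderate_on_def by blast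
qed

lemma negligible_on_add:
  assumes "negligible_on U K f" "negligible_on U K g"
  shows "negligible_on U K (\<lambda>\<phi> t. f \<phi> t + g \<phi> t)"
proof (rule negligible_onI)
  fix p
  have f: "\<forall>\<^sub>F \<phi> in U. \<forall>t\<in>K. cmod (f \<phi> t) \<le> radius \<phi> ^ p"
    and g: "\<forall>\<^sub>F \<phi> in U. \<forall>t\<in>K. cmod (g \<phi> t) \<le> radius \<phi> ^ p"
    using assms by (auto simp: negligible_on_def)
  from f g have "\<forall>\<^sub>F \<phi> in U. \<forall>t\<in>K. cmod (f \<phi> t + g \<phi> t) \<le> 2 * radius \<phi> ^ p"
    by eventually_elim (fastforce intro: norm_triangle_le)
  then show "\<exists>C. \<forall>\<^sub>F \<phi> in U. \<forall>t\<in>K. cmod (f \<phi> t + g \<phi> t) \<le> C * radius \<phi> ^ p" by blast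
qed

lemma negligible_on_mult:
  assumes "moderate_on U K f" "negligible_on U K g"
  shows "negligible_on U K (\<lambda>\<phi> t. f \<phi> t * g \<phi> t)"
  unfolding negligible_on_def
proof
  fix p
  obtain m where f: "\<forall>\<^sub>F \<phi> in U. \<forall>t\<in>K. cmod (f \<phi> t) \<le> 1 / radius \<phi> ^ m"
    using assms by (auto simp: moderate_on_def)
  have g: "\<forall>\<^sub>F \<phi> in U. \<forall>t\<in>K. cmod (g \<phi> t) \<le> radius \<phi> ^ (m + p)"
    using assms by (auto simp: negligible_on_def)
  from f g ev_radius_less[OF zero_less_one]
  show "\<forall>\<^sub>F \<phi> in U. \<forall>t\<in>K. cmod (f \<phi> t * g \<phi> t) \<le> radius \<phi> ^ p"
  proof eventually_elim
    case (elim \<phi>)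
    show ?case
    proof
      fix t assume "t \<in> K"
      then have "cmod (f \<phi> t) * cmod (g \<phi> t) \<le> 1 / radius \<phi> ^ m * radius \<phi> ^ (m + p)"
        using elim by (intro mult_mono) auto
      then show "cmod (f \<phi> t * g \<phi> t) \<le> radius \<phi> ^ p"
        using elim(3) by (simp add: norm_mult power_add)
    qed
  qed
qed

lemma negligible_on_moderate_on: "negligible_on U K f \<Longrightarrow> moderate_on U K f"
  unfolding negligible_on_def
  by (drule spec[of _ 0], rule moderate_onI[of _ _ 1 0]) simp

lemma moderate_on_const: "moderate_on U K (\<lambda>\<phi> t. c)"
  by (rule moderate_onI[of _ _ "cmod c" 0]) simp

lemma moderate_on_fixed:
  assumes "compact K" "continuous_on K h"
  shows "moderate_on U K (\<lambda>\<phi>. h)"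
proof -
  have "bounded (h ` K)" using assms by (simp add: compact_continuous_image compact_imp_bounded)
  then obtain C where "\<forall>t\<in>K. cmod (h t) \<le> C" by (auto simp: bounded_iff)
  then show ?thesis by (intro moderate_onI[of _ _ C 0]) simp
qed

lemma negligible_on_zero: "negligible_on U K (\<lambda>\<phi> t. 0)"
  by (rule negligible_onI) (auto intro!: exI[of _ 0])

lemma negligible_E_moderate_E: "f \<in> negligible_E U \<Longrightarrow> f \<in> moderate_E U"
  by (auto simp: moderate_E_iff negligible_E_iff intro: negligible_on_moderate_on)

lemma moderate_E_add:
  assumes "f \<in> moderate_E U" "g \<in> moderate_E U"
  shows "(\<lambda>\<phi> t. f \<phi> t + g \<phi> t) \<in> moderate_E U"
  using assms by (auto simp: moderate_E_iff vd_iterate_add smooth_add intro: moderate_on_add)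

lemma negligible_E_add:
  assumes "f \<in> negligible_E U" "g \<in> negligible_E U"
  shows "(\<lambda>\<phi> t. f \<phi> t + g \<phi> t) \<in> negligible_E U"
  using assms by (auto simp: negligible_E_iff vd_iterate_add smooth_add intro: negligible_on_add)

text \<open>
  The order of the derivative decreases in \<open>(f g)\<^bsup>(j+1)\<^esup> = (f' g)\<^bsup>(j)\<^esup> + (f g')\<^bsup>(j)\<^esup>\<close>, where the factors are
  again moderate, so an induction over all pairs replaces the Leibniz formula.
\<close>
lemma moderate_E_mult:
  assumes "f \<in> moderate_E U" "g \<in> moderate_E U"
  shows "(\<lambda>\<phi> t. f \<phi> t * g \<phi> t) \<in> moderate_E U"
proof -
  have "moderate_on U K (\<lambda>\<phi>. (vd ^^ j) (\<lambda>t. f \<phi> t * g \<phi> t))" if K: "compact K" for K j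
    using assms
  proof (induction j arbitrary: f g)
    case 0
    then show ?case using K by (simp add: moderate_on_mult moderate_E_on)
  next
    case (Suc j)
    have "(vd ^^ Suc j) (\<lambda>t. f \<phi> t * g \<phi> t) = (\<lambda>t. (vd ^^ j) (\<lambda>t. vd (f \<phi>) t * g \<phi> t) t
        + (vd ^^ j) (\<lambda>t. f \<phi> t * vd (g \<phi>) t) t)" for \<phi>
      unfolding vd_iterate_vd[symmetric]
      by (simp add: vd_mult vd_iterate_add smooth_mult smooth_vd smooth_moderate_E[OF Suc.prems(1)]
          smooth_moderate_E[OF Suc.prems(2)])
    then show ?case
      using moderate_on_add[OF Suc.IH[OF vd_moderate_E[OF Suc.prems(1)] Suc.prems(2)]
          Suc.IH[OF Suc.prems(1) vd_moderate_E[OF Suc.prems(2)]]] by simp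
  qed
  then show ?thesis using assms by (auto simp: moderate_E_iff smooth_mult)
qed

lemma negligible_E_mult:
  assumes "f \<in> moderate_E U" "g \<in> negligible_E U"
  shows "(\<lambda>\<phi> t. f \<phi> t * g \<phi> t) \<in> negligible_E U"
proof -
  have "negligible_on U K (\<lambda>\<phi>. (vd ^^ j) (\<lambda>t. f \<phi> t * g \<phi> t))" if K: "compact K" for K j
    using assms
  proof (induction j arbitrary: f g)
    case 0
    then show ?case using K by (simp add: negligible_on_mult moderate_E_on negligible_E_on)
  next
    case (Suc j)
    have "(vd ^^ Suc j) (\<lambda>t. f \<phi> t * g \<phi> t) = (\<lambda>t. (vd ^^ j) (\<lambda>t. vd (f \<phi>) t * g \<phi> t) t
        + (vd ^^ j) (\<lambda>t. f \<phi> t * vd (g \<phi>) t) t)" for \<phi>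
      unfolding vd_iterate_vd[symmetric]
      by (simp add: vd_mult vd_iterate_add smooth_mult smooth_vd smooth_moderate_E[OF Suc.prems(1)]
          smooth_negligible_E[OF Suc.prems(2)])
    then show ?case
      using negligible_on_add[OF Suc.IH[OF vd_moderate_E[OF Suc.prems(1)] Suc.prems(2)]
          Suc.IH[OF Suc.prems(1) vd_negligible_E[OF Suc.prems(2)]]] by simp
  qed
  then show ?thesis using assms by (auto simp: moderate_E_iff negligible_E_iff smooth_mult)
qed

lemma moderate_E_fixed: "smooth h \<Longrightarrow> (\<lambda>\<phi>. h) \<in> moderate_E U"
  by (auto simp: moderate_E_iff smooth_iterate smooth_continuous_on intro: moderate_on_fixed)

lemma moderate_E_const:
  assumes "A \<in> moderate_C U" shows "(\<lambda>\<phi> t. A \<phi>) \<in> moderate_E U"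
proof -
  have "moderate_on U K (\<lambda>\<phi> t. A \<phi>)" for K
    using assms unfolding moderate_C_def moderate_on_def by (auto elim!: eventually_mono)
  then have "moderate_on U K (\<lambda>\<phi> t. if j = 0 then A \<phi> else 0)" for K and j :: nat
    by (cases "j = 0") (simp_all add: moderate_on_const)
  then show ?thesis by (simp add: moderate_E_iff smooth_const vd_iterate_const)
qed

lemma negligible_E_const:
  assumes "A \<in> negligible_C U" shows "(\<lambda>\<phi> t. A \<phi>) \<in> negligible_E U"
proof -
  have "negligible_on U K (\<lambda>\<phi> t. A \<phi>)" for K
    using assms unfolding negligible_C_def negligible_on_def by (auto elim!: eventually_mono)
  then have "negligible_on U K (\<lambda>\<phi> t. if j = 0 then A \<phi> else 0)" for K and j :: nat
    by (cases "j = 0") (simp_all add: negligible_on_zero)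
  then show ?thesis by (simp add: negligible_E_iff smooth_const vd_iterate_const)
qed

lemma moderate_C_const: "(\<lambda>\<phi>. c) \<in> moderate_C U"
  unfolding moderate_C_iff[of _ _ 0] by (rule moderate_on_const)

lemma negligible_E_zero: "(\<lambda>\<phi> t. 0) \<in> negligible_E U"
  by (rule negligible_E_const) (simp add: negligible_C_iff[of _ _ 0] negligible_on_zero)

lemma moderate_E_cmult: "f \<in> moderate_E U \<Longrightarrow> (\<lambda>\<phi> t. c * f \<phi> t) \<in> moderate_E U"
  by (rule moderate_E_mult[OF moderate_E_const[OF moderate_C_const]])

lemma negligible_E_cmult: "f \<in> negligible_E U \<Longrightarrow> (\<lambda>\<phi> t. c * f \<phi> t) \<in> negligible_E U"
  by (rule negligible_E_mult[OF moderate_E_const[OF moderate_C_const]])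

lemma moderate_E_diff:
  "f \<in> moderate_E U \<Longrightarrow> g \<in> moderate_E U \<Longrightarrow> (\<lambda>\<phi> t. f \<phi> t - g \<phi> t) \<in> moderate_E U"
  using moderate_E_add[OF _ moderate_E_cmult[of g "-1"], of f] by simp

lemma negligible_E_diff:
  "f \<in> negligible_E U \<Longrightarrow> g \<in> negligible_E U \<Longrightarrow> (\<lambda>\<phi> t. f \<phi> t - g \<phi> t) \<in> negligible_E U"
  using negligible_E_add[OF _ negligible_E_cmult[of g "-1"], of f] by simp

lemma moderate_E_sum:
  "(\<And>i. i \<in> I \<Longrightarrow> f i \<in> moderate_E U) \<Longrightarrow> (\<lambda>\<phi> t. \<Sum>i\<in>I. f i \<phi> t) \<in> moderate_E U"
  by (induction I rule: infinite_finite_induct)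
    (auto intro: moderate_E_add moderate_E_fixed smooth_const)

lemma negligible_C_diff:
  "A \<in> negligible_C U \<Longrightarrow> B \<in> negligible_C U \<Longrightarrow> (\<lambda>\<phi>. A \<phi> - B \<phi>) \<in> negligible_C U"
  using value_negligible_E[OF negligible_E_diff[OF negligible_E_const negligible_E_const]] by blast

lemma negligible_C_add:
  "A \<in> negligible_C U \<Longrightarrow> B \<in> negligible_C U \<Longrightarrow> (\<lambda>\<phi>. A \<phi> + B \<phi>) \<in> negligible_C U"
  using value_negligible_E[OF negligible_E_add[OF negligible_E_const negligible_E_const]] by blast

end

section \<open>The quotient algebra\<close>

context mollifier_filter
begin

lemma moderate_E_uminus: "f \<in> moderate_E U \<Longrightarrow> (\<lambda>\<phi> t. - f \<phi> t) \<in> moderate_E U"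
  using moderate_E_cmult[of f "-1"] by simp

lemma negligible_E_uminus: "f \<in> negligible_E U \<Longrightarrow> (\<lambda>\<phi> t. - f \<phi> t) \<in> negligible_E U"
  using negligible_E_cmult[of f "-1"] by simp

lemma cring_moderate_ring_E: "cring (moderate_ring_E U)"
proof (rule cringI)
  show "abelian_group (moderate_ring_E U)"
  proof (rule abelian_groupI)
    fix f assume "f \<in> carrier (moderate_ring_E U)"
    then show "\<exists>g\<in>carrier (moderate_ring_E U). g \<oplus>\<^bsub>moderate_ring_E U\<^esub> f = \<zero>\<^bsub>moderate_ring_E U\<^esub>"
      by (intro bexI[of _ "\<lambda>\<phi> t. - f \<phi> t"]) (auto simp: moderate_ring_E_def moderate_E_uminus)
  qed (auto simp: moderate_ring_E_def fun_eq_iff add_ac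
      intro: moderate_E_add moderate_E_fixed smooth_const)
  show "Group.comm_monoid (moderate_ring_E U)"
    by (rule comm_monoidI)
      (auto simp: moderate_ring_E_def fun_eq_iff mult_ac intro: moderate_E_mult moderate_E_fixed smooth_const)
qed (auto simp: moderate_ring_E_def fun_eq_iff distrib_right)

lemma moderate_ring_E_uminus:
  assumes "f \<in> moderate_E U"
  shows "\<ominus>\<^bsub>moderate_ring_E U\<^esub> f = (\<lambda>\<phi> t. - f \<phi> t)"
proof -
  interpret cring "moderate_ring_E U" by (rule cring_moderate_ring_E)
  show ?thesis
    using assms by (intro minus_equality) (auto simp: moderate_ring_E_def moderate_E_uminus)
qed

lemma ideal_negligible_E: "ideal (negligible_E U) (moderate_ring_E U)"
proof (rule idealI)
  interpret cring "moderate_ring_E U" by (rule cring_moderate_ring_E)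
  show "ring (moderate_ring_E U)" ..
  show "subgroup (negligible_E U) (add_monoid (moderate_ring_E U))"
  proof (rule add.subgroupI)
    show "negligible_E U \<subseteq> carrier (moderate_ring_E U)"
      by (auto simp: moderate_ring_E_def intro: negligible_E_moderate_E)
    show "negligible_E U \<noteq> {}" using negligible_E_zero by blast
    fix f assume "f \<in> negligible_E U"
    then show "\<ominus>\<^bsub>moderate_ring_E U\<^esub> f \<in> negligible_E U"
      by (simp add: moderate_ring_E_uminus negligible_E_moderate_E negligible_E_uminus)
  next
    fix f g assume "f \<in> negligible_E U" "g \<in> negligible_E U"
    then show "f \<oplus>\<^bsub>moderate_ring_E U\<^esub> g \<in> negligible_E U"
      by (simp add: moderate_ring_E_def negligible_E_add)
  qed
  fix f g assume "f \<in> negligible_E U" "g \<in> carrier (moderate_ring_E U)"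
  then have "(\<lambda>\<phi> t. g \<phi> t * f \<phi> t) \<in> negligible_E U"
    by (intro negligible_E_mult) (auto simp: moderate_ring_E_def)
  then show "g \<otimes>\<^bsub>moderate_ring_E U\<^esub> f \<in> negligible_E U" "f \<otimes>\<^bsub>moderate_ring_E U\<^esub> g \<in> negligible_E U"
    by (simp_all add: moderate_ring_E_def mult.commute)
qed

sublocale moderate: cring "moderate_ring_E U"
  rewrites "carrier (moderate_ring_E U) = moderate_E U"
  by (rule cring_moderate_ring_E) (simp add: moderate_ring_E_def)

sublocale negligible: ideal "negligible_E U" "moderate_ring_E U"
  rewrites "carrier (moderate_ring_E U) = moderate_E U"
  by (rule ideal_negligible_E) (simp add: moderate_ring_E_def)

lemma cring_E_hat: "cring (E_hat U)"
  unfolding E_hat_def by (rule negligible.quotient_is_cring) (rule cring_moderate_ring_E)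

lemma carrier_E_hat: "carrier (E_hat U) = class_E U ` moderate_E U"
  by (auto simp: E_hat_def FactRing_def A_RCOSETS_def' class_E_def moderate_ring_E_def)

lemma class_E_hom: "class_E U \<in> ring_hom (moderate_ring_E U) (E_hat U)"
  using negligible.rcos_ring_hom by (simp add: class_E_def[abs_def] E_hat_def)

lemma class_E_add: "f \<in> moderate_E U \<Longrightarrow> g \<in> moderate_E U \<Longrightarrow>
    class_E U f \<oplus>\<^bsub>E_hat U\<^esub> class_E U g = class_E U (\<lambda>\<phi> t. f \<phi> t + g \<phi> t)"
  using ring_hom_add[OF class_E_hom, of f g] by (simp add: moderate_ring_E_def)

lemma class_E_mult: "f \<in> moderate_E U \<Longrightarrow> g \<in> moderate_E U \<Longrightarrow>
    class_E U f \<otimes>\<^bsub>E_hat U\<^esub> class_E U g = class_E U (\<lambda>\<phi> t. f \<phi> t * g \<phi> t)"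
  using ring_hom_mult[OF class_E_hom, of f g] by (simp add: moderate_ring_E_def)

lemma class_E_zero: "\<zero>\<^bsub>E_hat U\<^esub> = class_E U (\<lambda>\<phi> t. 0)"
  using ring_hom_zero[OF class_E_hom] cring.axioms(1)[OF cring_moderate_ring_E] cring.axioms(1)[OF cring_E_hat]
  by (simp add: moderate_ring_E_def)

lemma class_E_diff:
  assumes "f \<in> moderate_E U" "g \<in> moderate_E U"
  shows "class_E U f \<ominus>\<^bsub>E_hat U\<^esub> class_E U g = class_E U (\<lambda>\<phi> t. f \<phi> t - g \<phi> t)"
proof -
  interpret Q: cring "E_hat U" by (rule cring_E_hat)
  note m = moderate_E_uminus[OF assms(2)]
  have "class_E U (\<lambda>\<phi> t. - g \<phi> t) \<oplus>\<^bsub>E_hat U\<^esub> class_E U g = \<zero>\<^bsub>E_hat U\<^esub>"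
    by (simp add: class_E_add[OF m assms(2)] class_E_zero)
  then have "\<ominus>\<^bsub>E_hat U\<^esub> class_E U g = class_E U (\<lambda>\<phi> t. - g \<phi> t)"
    by (intro Q.minus_equality) (use m assms in \<open>auto simp: carrier_E_hat\<close>)
  then show ?thesis by (simp add: a_minus_def class_E_add[OF assms(1) m])
qed

lemma class_E_eq_iff:
  assumes "f \<in> moderate_E U" "g \<in> moderate_E U"
  shows "class_E U f = class_E U g \<longleftrightarrow> (\<lambda>\<phi> t. f \<phi> t - g \<phi> t) \<in> negligible_E U"
proof -
  have "f \<ominus>\<^bsub>moderate_ring_E U\<^esub> g = (\<lambda>\<phi> t. f \<phi> t - g \<phi> t)"
    by (simp add: a_minus_def moderate_ring_E_uminus[OF assms(2)]) (simp add: moderate_ring_E_def)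
  then show ?thesis
    using moderate.quotient_eq_iff_same_a_r_cos[OF ideal_negligible_E assms] by (simp add: class_E_def)
qed

lemma class_E_self: "f \<in> moderate_E U \<Longrightarrow> f \<in> class_E U f"
  using negligible.a_rcos_self by (simp add: class_E_def)

lemma class_E_mem:
  assumes "f \<in> moderate_E U" "h \<in> class_E U f"
  shows "h \<in> moderate_E U" "(\<lambda>\<phi> t. h \<phi> t - f \<phi> t) \<in> negligible_E U"
proof -
  obtain n where n: "n \<in> negligible_E U" "h = (\<lambda>\<phi> t. n \<phi> t + f \<phi> t)"
    using assms(2) by (auto simp: class_E_def a_r_coset_def' moderate_ring_E_def)
  then show "h \<in> moderate_E U" "(\<lambda>\<phi> t. h \<phi> t - f \<phi> t) \<in> negligible_E U"
    using assms(1) by (auto intro: moderate_E_add negligible_E_moderate_E)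
qed

lemma class_C_eq: "class_C U A = {B. (\<lambda>\<phi>. B \<phi> - A \<phi>) \<in> negligible_C U}"
proof (intro equalityI subsetI)
  fix B assume "B \<in> {B. (\<lambda>\<phi>. B \<phi> - A \<phi>) \<in> negligible_C U}"
  then show "B \<in> class_C U A"
    unfolding class_C_def a_r_coset_def' moderate_ring_C_def
    by (auto intro!: bexI[of _ "\<lambda>\<phi>. B \<phi> - A \<phi>"])
qed (auto simp: class_C_def a_r_coset_def' moderate_ring_C_def)

lemma class_C_cong:
  assumes "(\<lambda>\<phi>. A \<phi> - B \<phi>) \<in> negligible_C U"
  shows "class_C U A = class_C U B"
proof -
  have "(\<lambda>\<phi>. C \<phi> - A \<phi>) \<in> negligible_C U \<longleftrightarrow> (\<lambda>\<phi>. C \<phi> - B \<phi>) \<in> negligible_C U" for C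
    using negligible_C_add[of "\<lambda>\<phi>. C \<phi> - A \<phi>", OF _ assms]
      negligible_C_diff[of "\<lambda>\<phi>. C \<phi> - B \<phi>", OF _ assms] by auto
  then show ?thesis by (simp add: class_C_eq)
qed

lemma zero_C_hat: "\<zero>\<^bsub>C_hat U\<^esub> = negligible_C U"
  by (simp add: C_hat_def FactRing_def)

lemma negligible_C_zero: "(\<lambda>\<phi>. 0) \<in> negligible_C U"
  using value_negligible_E[OF negligible_E_zero] .

lemma class_C_eq_zero_iff: "class_C U A = \<zero>\<^bsub>C_hat U\<^esub> \<longleftrightarrow> A \<in> negligible_C U"
  unfolding zero_C_hat
proof
  assume "class_C U A = negligible_C U"
  moreover have "A \<in> class_C U A" by (simp add: class_C_eq negligible_C_zero)
  ultimately show "A \<in> negligible_C U" by simp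
next
  assume "A \<in> negligible_C U"
  then have "class_C U A = class_C U (\<lambda>\<phi>. 0)" by (intro class_C_cong) simp
  then show "class_C U A = negligible_C U" by (simp add: class_C_eq)
qed

lemma carrier_C_hat: "carrier (C_hat U) = class_C U ` moderate_C U"
  by (auto simp: C_hat_def FactRing_def A_RCOSETS_def' class_C_def moderate_ring_C_def)

lemma deriv_hat_class:
  assumes "f \<in> moderate_E U"
  shows "deriv_hat U (class_E U f) = class_E U (\<lambda>\<phi>. vd (f \<phi>))"
proof -
  have "class_E U (\<lambda>\<phi>. vd (h \<phi>)) = class_E U (\<lambda>\<phi>. vd (f \<phi>))" if "h \<in> class_E U f" for h
  proof -
    note h = class_E_mem[OF assms that]
    show ?thesis
      using vd_negligible_E[OF h(2)] assms h(1)
      by (simp add: class_E_eq_iff vd_moderate_E vd_diff smooth_moderate_E)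
  qed
  then show ?thesis
    unfolding deriv_hat_def using class_E_self[OF assms] by (intro SUP_eq_const) blast+
qed

lemma value_hat_class:
  assumes "f \<in> moderate_E U"
  shows "value_hat U (class_E U f) x = class_C U (\<lambda>\<phi>. f \<phi> x)"
proof -
  have "class_C U (\<lambda>\<phi>. h \<phi> x) = class_C U (\<lambda>\<phi>. f \<phi> x)" if "h \<in> class_E U f" for h
    by (rule class_C_cong) (rule value_negligible_E[OF class_E_mem(2)[OF assms that]])
  then show ?thesis
    unfolding value_hat_def using class_E_self[OF assms] by (intro SUP_eq_const) blast+
qed

lemma const_hat_class:
  assumes "A \<in> moderate_C U"
  shows "const_hat U (class_C U A) = class_E U (\<lambda>\<phi> t. A \<phi>)"
proof -
  have "class_E U (\<lambda>\<phi> t. B \<phi>) = class_E U (\<lambda>\<phi> t. A \<phi>)" if "B \<in> class_C U A" for B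
  proof -
    have n: "(\<lambda>\<phi> t. B \<phi> - A \<phi>) \<in> negligible_E U"
      using that by (intro negligible_E_const) (simp add: class_C_eq)
    have "(\<lambda>\<phi> t. B \<phi>) \<in> moderate_E U"
      using moderate_E_add[OF negligible_E_moderate_E[OF n] moderate_E_const[OF assms]] by simp
    then show ?thesis
      using n assms by (simp add: class_E_eq_iff moderate_E_const)
  qed
  moreover have "A \<in> class_C U A" by (simp add: class_C_eq negligible_C_zero)
  ultimately show ?thesis unfolding const_hat_def by (intro SUP_eq_const) blast+
qed

lemma scale_hat_class:
  "A \<in> moderate_C U \<Longrightarrow> f \<in> moderate_E U \<Longrightarrow>
    scale_hat U (class_C U A) (class_E U f) = class_E U (\<lambda>\<phi> t. A \<phi> * f \<phi> t)"
  by (simp add: scale_hat_def const_hat_class class_E_mult moderate_E_const)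

lemma scale_number_hat_class:
  "f \<in> moderate_E U \<Longrightarrow> scale_hat U (number_hat U c) (class_E U f) = class_E U (\<lambda>\<phi> t. c * f \<phi> t)"
  by (simp add: number_hat_def scale_hat_class moderate_C_const)

lemma finsum_class_E:
  assumes "finite I" "\<And>i. i \<in> I \<Longrightarrow> f i \<in> moderate_E U"
  shows "(\<Oplus>\<^bsub>E_hat U\<^esub>i\<in>I. class_E U (f i)) = class_E U (\<lambda>\<phi> t. \<Sum>i\<in>I. f i \<phi> t)"
proof -
  interpret Q: cring "E_hat U" by (rule cring_E_hat)
  show ?thesis using assms
  proof (induction I)
    case empty
    then show ?case by (simp add: class_E_zero)
  next
    case (insert i I)
    then have "(\<Oplus>\<^bsub>E_hat U\<^esub>i\<in>insert i I. class_E U (f i)) =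
        class_E U (f i) \<oplus>\<^bsub>E_hat U\<^esub> (\<Oplus>\<^bsub>E_hat U\<^esub>i\<in>I. class_E U (f i))"
      by (intro Q.finsum_insert) (auto simp: carrier_E_hat)
    with insert show ?case by (simp add: class_E_add moderate_E_sum)
  qed
qed

section \<open>Embedded distributions\<close>

text \<open>
  On a compact set, \<open>T \<star> \<phi>\<close> and its derivatives are controlled by finitely many derivatives of \<open>\<phi>\<close>,
  and these are bounded by powers of \<open>1/R\<^sub>\<phi>\<close> in the definition of \<open>\<D>\<^sub>n\<close>.
\<close>
lemma moderate_dist_conv_test:
  assumes T: "T \<in> distributions"
  shows "dist_conv_test T \<in> moderate_E U"
  unfolding moderate_E_iff
proof (intro conjI allI impI)
  show "smooth (dist_conv_test T \<phi>)" for \<phi> by (rule smooth_dist_conv_test[OF T])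
  fix K :: "real set" and j assume "compact K"
  then obtain L where L: "\<And>t. t \<in> K \<Longrightarrow> \<bar>t\<bar> \<le> L"
    using compact_imp_bounded[OF \<open>compact K\<close>] by (auto simp: bounded_iff)
  obtain C N where C: "C \<ge> 0" "\<And>\<phi> M. (\<And>x. \<bar>x\<bar> > L + 1 \<Longrightarrow> fn \<phi> x = 0) \<Longrightarrow>
    (\<And>j x. j \<le> N \<Longrightarrow> cmod ((vd ^^ j) (fn \<phi>) x) \<le> M) \<Longrightarrow> cmod (T \<phi>) \<le> C * M"
    using distribution_bound[OF T] by blast
  have "\<forall>\<^sub>F \<phi> in U. \<forall>t\<in>K. cmod ((vd ^^ j) (dist_conv_test T \<phi>) t) \<le> C / radius \<phi> ^ (2 * (N + j + 1 + 1))"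
    using ev_mollifier[of "N + j + 1"] ev_radius_less[OF zero_less_one]
  proof eventually_elim
    case (elim \<phi>)
    have 1: "cmod ((vd ^^ i) (fn \<phi>) x) \<le> 1 / radius \<phi> ^ (2 * (N + j + 1 + 1))" if "i \<le> N + j + 1" for i x
    proof -
      have "cmod ((vd ^^ i) (fn \<phi>) x) \<le> 1 / radius \<phi> ^ (2 * (i + 1))"
        using elim(1) that by (simp add: mollifiers_def)
      also have "\<dots> \<le> 1 / radius \<phi> ^ (2 * (N + j + 1 + 1))"
        using elim(2) that by (intro divide_left_mono power_decreasing) auto
      finally show ?thesis .
    qed
    show ?case
    proof
      fix t assume t: "t \<in> K"
      have "cmod (T (reflect_test t ((deriv_test ^^ j) \<phi>))) \<le> C * (1 / radius \<phi> ^ (2 * (N + j + 1 + 1)))"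
      proof (rule C(2))
        fix x assume x: "\<bar>x\<bar> > L + 1"
        have "(vd ^^ i) (fn \<phi>) y = 0" if "y \<in> {..<-1} \<union> {1<..}" for i y
          using that
        proof (induction i arbitrary: y)
          case 0
          then show ?case using elim(2) fn_eq_0_outside_radius[of \<phi> y] by auto
        next
          case (Suc i)
          show ?case
            unfolding funpow.simps o_def
            by (rule vd_eq_0_outside[OF open_Un[OF open_lessThan open_greaterThan] Suc.prems]) (rule Suc.IH)
        qed
        moreover have "t - x \<in> {..<-1} \<union> {1<..}" using L[OF t] x by (auto simp: abs_if split: if_splits)
        ultimately have "(vd ^^ j) (fn \<phi>) (t - x) = 0" by blast
        then show "fn (reflect_test t ((deriv_test ^^ j) \<phi>)) x = 0"
          by (simp add: reflect_test.rep_eq fn_deriv_iterate)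
      next
        fix i x assume i: "i \<le> N"
        have "(vd ^^ i) ((vd ^^ j) (fn \<phi>)) = (vd ^^ (i + j)) (fn \<phi>)" by (simp add: funpow_add)
        then show "cmod ((vd ^^ i) (fn (reflect_test t ((deriv_test ^^ j) \<phi>))) x) \<le> 1 / radius \<phi> ^ (2 * (N + j + 1 + 1))"
          using 1[of "i + j" "t - x"] i by (simp add: fn_reflect_derivative fn_deriv_iterate norm_mult norm_power)
      qed
      then show "cmod ((vd ^^ j) (dist_conv_test T \<phi>) t) \<le> C / radius \<phi> ^ (2 * (N + j + 1 + 1))"
        unfolding vd_iterate_dist_conv_test[OF T] by (simp add: dist_conv_test_def)
    qed
  qed
  then show "moderate_on U K (\<lambda>\<phi>. (vd ^^ j) (dist_conv_test T \<phi>))" by (rule moderate_onI)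
qed

lemma iota_class: "iota U T = class_E U (dist_conv_test T)"
  by (simp add: iota_def)

text \<open>
  The representative of \<open>\<Sum>\<^sub>n \<alpha>\<^sub>n \<iota>(T\<^sub>n)\<close> that is obtained from representatives of the coefficients.
\<close>
definition comb_net :: "nat \<Rightarrow> (nat \<Rightarrow> test_fun \<Rightarrow> complex) \<Rightarrow> (nat \<Rightarrow> test_fun \<Rightarrow> complex)
    \<Rightarrow> test_fun \<Rightarrow> real \<Rightarrow> complex" where
  "comb_net m A T \<phi> t = (\<Sum>n\<in>{1..m}. A n \<phi> * dist_conv_test (T n) \<phi> t)"

lemma moderate_comb_net:
  assumes "\<And>n. n \<in> {1..m} \<Longrightarrow> A n \<in> moderate_C U \<and> T n \<in> distributions"
  shows "comb_net m A T \<in> moderate_E U"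
  unfolding comb_net_def[abs_def]
  by (intro moderate_E_sum moderate_E_mult moderate_E_const moderate_dist_conv_test) (use assms in auto)

lemma lin_comb_class:
  assumes "\<And>n. n \<in> {1..m} \<Longrightarrow> A n \<in> moderate_C U \<and> T n \<in> distributions"
    and "\<And>n. n \<in> {1..m} \<Longrightarrow> \<alpha> n = class_C U (A n)"
  shows "lin_comb U m \<alpha> T = class_E U (comb_net m A T)"
proof -
  interpret Q: cring "E_hat U" by (rule cring_E_hat)
  have mod: "(\<lambda>\<phi> t. A n \<phi> * dist_conv_test (T n) \<phi> t) \<in> moderate_E U" if "n \<in> {1..m}" for n
    using assms(1)[OF that] by (intro moderate_E_mult moderate_E_const moderate_dist_conv_test) auto
  have "lin_comb U m \<alpha> T = (\<Oplus>\<^bsub>E_hat U\<^esub>n\<in>{1..m}. class_E U (\<lambda>\<phi> t. A n \<phi> * dist_conv_test (T n) \<phi> t))"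
    unfolding lin_comb_def
  proof (rule Q.finsum_cong')
    show "(\<lambda>n. class_E U (\<lambda>\<phi> t. A n \<phi> * dist_conv_test (T n) \<phi> t)) \<in> {1..m} \<rightarrow> carrier (E_hat U)"
      using mod by (auto simp: carrier_E_hat)
    fix n assume "n \<in> {1..m}"
    then show "scale_hat U (\<alpha> n) (iota U (T n)) = class_E U (\<lambda>\<phi> t. A n \<phi> * dist_conv_test (T n) \<phi> t)"
      using assms by (simp add: iota_class scale_hat_class moderate_dist_conv_test)
  qed simp
  also have "\<dots> = class_E U (comb_net m A T)"
    unfolding comb_net_def[abs_def] by (rule finsum_class_E) (use mod in auto)
  finally show ?thesis .
qed

text \<open>
  The constant in the a priori estimate does not depend on \<open>\<phi>\<close>, so the estimate makes the net itself
  negligible; the derivatives follow one by one from the equation.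
\<close>
lemma linear_ode_negligible:
  assumes "a \<noteq> 0" and y: "y \<in> moderate_E U"
    and eq: "(\<lambda>\<phi> t. of_real a * vd (y \<phi>) t + of_real b * y \<phi> t) \<in> negligible_E U"
    and x0: "(\<lambda>\<phi>. y \<phi> x0) \<in> negligible_C U"
  shows "y \<in> negligible_E U"
proof -
  have "negligible_on U K (\<lambda>\<phi>. (vd ^^ j) (y \<phi>))" if K: "compact K" for K j
  proof (induction j)
    case 0
    obtain L0 where L0: "\<And>t. t \<in> K \<Longrightarrow> \<bar>t\<bar> \<le> L0"
      using compact_imp_bounded[OF K] by (auto simp: bounded_iff)
    define L where "L = max L0 \<bar>x0\<bar>"
    let ?C = "exp (\<bar>b / a\<bar> * L) * exp (\<bar>b / a\<bar> * L) * (1 + 2 * L / \<bar>a\<bar>)"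
    have "negligible_on U K y"
    proof (rule negligible_onI)
      fix p
      have "\<forall>\<^sub>F \<phi> in U. cmod (y \<phi> x0) \<le> radius \<phi> ^ p"
        using x0 by (simp add: negligible_C_def)
      moreover have "\<forall>\<^sub>F \<phi> in U. \<forall>s\<in>{-L..L}. cmod (of_real a * vd (y \<phi>) s + of_real b * y \<phi> s) \<le> radius \<phi> ^ p"
        using negligible_E_on[OF eq compact_Icc] by (simp add: negligible_on_def)
      ultimately have "\<forall>\<^sub>F \<phi> in U. \<forall>t\<in>K. cmod (y \<phi> t) \<le> ?C * 2 * radius \<phi> ^ p"
      proof eventually_elim
        case (elim \<phi>)
        show ?case
        proof
          fix t assume "t \<in> K"
          then have t: "\<bar>t\<bar> \<le> L" using L0[of t] by (simp add: L_def)
          have "cmod (y \<phi> t) \<le> ?C * (cmod (y \<phi> x0) + radius \<phi> ^ p)"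
          proof (rule linear_ode_estimate[OF \<open>a \<noteq> 0\<close> smooth_moderate_E[OF y] _ _ t])
            fix s :: real assume "\<bar>s\<bar> \<le> L"
            then have "s \<in> {-L..L}" by auto
            with elim(2) show "cmod (of_real a * vd (y \<phi>) s + of_real b * y \<phi> s) \<le> radius \<phi> ^ p" by blast
          qed (simp add: L_def)
          also have "\<dots> \<le> ?C * (radius \<phi> ^ p + radius \<phi> ^ p)"
            using elim(1) t by (intro mult_left_mono add_right_mono) auto
          finally show "cmod (y \<phi> t) \<le> ?C * 2 * radius \<phi> ^ p" by simp
        qed
      qed
      then show "\<exists>C. \<forall>\<^sub>F \<phi> in U. \<forall>t\<in>K. cmod (y \<phi> t) \<le> C * radius \<phi> ^ p" by blast
    qed
    then show ?case by simp
  next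
    case (Suc j)
    \<comment> \<open>The equation expresses the highest derivative by lower ones and the negligible right side.\<close>
    have "(vd ^^ Suc j) (y \<phi>) t = of_real (1 / a) *
        (vd ^^ j) (\<lambda>t. of_real a * vd (y \<phi>) t + of_real b * y \<phi> t) t + of_real (- b / a) * (vd ^^ j) (y \<phi>) t" for \<phi> t
      using \<open>a \<noteq> 0\<close> smooth_moderate_E[OF y, of \<phi>]
      by (simp add: vd_iterate_add vd_iterate_cmult smooth_cmult smooth_vd vd_iterate_vd field_simps)
    moreover have "negligible_on U K (\<lambda>\<phi> t. of_real (1 / a) *
        (vd ^^ j) (\<lambda>t. of_real a * vd (y \<phi>) t + of_real b * y \<phi> t) t + of_real (- b / a) * (vd ^^ j) (y \<phi>) t)"
      by (intro negligible_on_add negligible_on_mult moderate_on_const Suc.IH negligible_E_derivative_on[OF eq K])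
    ultimately show ?case by presburger
  qed
  then show ?thesis using y by (simp add: negligible_E_iff moderate_E_iff)
qed

lemma integrable_fn_mult:
  assumes "continuous_on UNIV f"
  shows "integrable lborel (\<lambda>s. f s * fn \<phi> s)"
proof -
  obtain L where L: "L > 0" "\<And>x. \<bar>x\<bar> \<ge> L \<Longrightarrow> fn \<phi> x = 0"
    using fn_bounded_support[of \<phi>] by blast
  have "integrable lborel (\<lambda>s. indicator {-L..L} s *\<^sub>R (f s * fn \<phi> s))"
    by (intro borel_integrable_compact continuous_intros smooth_continuous_on smooth_fn
        continuous_on_subset[OF assms]) auto
  moreover have "indicator {-L..L} s *\<^sub>R (f s * fn \<phi> s) = f s * fn \<phi> s" for s
  proof (cases "s \<in> {-L..L}")
    case False
    then have "fn \<phi> s = 0" using L(1) by (intro L(2)) auto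
    then show ?thesis by simp
  qed simp
  ultimately show ?thesis by simp
qed

text \<open>
  All moments of order \<open>1, \<dots>, n\<close> of a mollifier in \<open>\<D>\<^sub>n\<close> vanish, so only the Taylor remainder of the
  exponential function survives in the integral, and on the support of \<open>\<phi>\<close> it is \<open>O(R\<^sub>\<phi>\<^bsup>n+1\<^esup>)\<close>.
\<close>
lemma mollified_exp_negligible:
  "(\<lambda>\<phi>. (LINT s|lborel. of_real (exp (c * s)) * fn \<phi> s) - 1) \<in> negligible_C U"
  unfolding negligible_C_iff[of _ _ 0]
proof (rule negligible_onI)
  fix p
  define n where "n = Suc p"
  define P where "P s = (\<Sum>i\<le>n. (c * s) ^ i / fact i)" for s :: real
  define D where "D = exp \<bar>c\<bar> * \<bar>c\<bar> ^ Suc n / fact n"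
  have "\<forall>\<^sub>F \<phi> in U. cmod ((LINT s|lborel. of_real (exp (c * s)) * fn \<phi> s) - 1) \<le> (D * 2) * radius \<phi> ^ p"
    using ev_mollifier[of n] ev_radius_less[OF zero_less_one]
  proof eventually_elim
    case (elim \<phi>)
    have intf: "integrable lborel (\<lambda>s. of_real (f s) * fn \<phi> s)" if "continuous_on UNIV f" for f :: "real \<Rightarrow> real"
      by (intro integrable_fn_mult continuous_intros that)
    have contP: "continuous_on UNIV P" unfolding P_def by (intro continuous_intros) simp
    have moment: "(LINT s|lborel. of_real ((c * s) ^ i / fact i) * fn \<phi> s) = (if i = 0 then 1 else 0)"
      if "i \<le> n" for i
    proof -
      have "(LINT s|lborel. of_real ((c * s) ^ i / fact i) * fn \<phi> s) =
          (LINT s|lborel. of_real (c ^ i / fact i) * (of_real (s ^ i) * fn \<phi> s))"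
        by (intro Bochner_Integration.integral_cong) (auto simp: power_mult_distrib)
      also have "\<dots> = of_real (c ^ i / fact i) * (LINT s|lborel. of_real (s ^ i) * fn \<phi> s)"
        by (rule integral_mult_right_zero)
      finally show ?thesis
        using elim(1) that by (cases "i = 0") (auto simp: mollifiers_def n_def)
    qed
    have "(LINT s|lborel. of_real (P s) * fn \<phi> s) =
        (\<Sum>i\<le>n. LINT s|lborel. of_real ((c * s) ^ i / fact i) * fn \<phi> s)"
      unfolding P_def of_real_sum sum_distrib_right
      by (rule Bochner_Integration.integral_sum) (intro intf continuous_intros, simp)
    also have "\<dots> = (\<Sum>i\<le>n. if i = 0 then 1 else 0)"
      by (intro sum.cong refl moment) simp
    also have "\<dots> = 1" by simp
    finally have "(LINT s|lborel. of_real (exp (c * s)) * fn \<phi> s) - 1 =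
        (LINT s|lborel. of_real (exp (c * s)) * fn \<phi> s) - (LINT s|lborel. of_real (P s) * fn \<phi> s)" by simp
    also have "\<dots> = (LINT s|lborel. of_real (exp (c * s) - P s) * fn \<phi> s)"
      unfolding of_real_diff left_diff_distrib
      by (rule Bochner_Integration.integral_diff[symmetric]) (intro intf contP continuous_intros)+
    also have "cmod \<dots> \<le> (LINT s|lborel. D * radius \<phi> ^ Suc n * cmod (fn \<phi> s))"
    proof (rule Bochner_Integration.integral_norm_bound_integral)
      show "integrable lborel (\<lambda>s. of_real (exp (c * s) - P s) * fn \<phi> s)"
        by (intro intf contP continuous_intros)
      show "integrable lborel (\<lambda>s. D * radius \<phi> ^ Suc n * cmod (fn \<phi> s))"
        using intf[of "\<lambda>_. 1"] by (intro integrable_mult_right integrable_norm) simp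
      fix s :: real
      show "cmod (of_real (exp (c * s) - P s) * fn \<phi> s) \<le> D * radius \<phi> ^ Suc n * cmod (fn \<phi> s)"
      proof (cases "\<bar>s\<bar> > radius \<phi>")
        case True then show ?thesis by (simp add: fn_eq_0_outside_radius)
      next
        case False
        have cs: "\<bar>c * s\<bar> \<le> \<bar>c\<bar> * radius \<phi>" "\<bar>c * s\<bar> \<le> \<bar>c\<bar> * 1"
          using False elim(2) unfolding abs_mult by (intro mult_left_mono; simp)+
        have "\<bar>exp (c * s) - P s\<bar> \<le> exp \<bar>c * s\<bar> * \<bar>c * s\<bar> ^ Suc n / fact n"
          using Taylor_exp_field[of "c * s" n] by (simp add: P_def)
        also have "\<dots> \<le> exp \<bar>c\<bar> * (\<bar>c\<bar> * radius \<phi>) ^ Suc n / fact n"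
          using cs elim(2) by (intro divide_right_mono mult_mono power_mono) auto
        also have "\<dots> = D * radius \<phi> ^ Suc n"
          by (simp add: D_def power_mult_distrib)
        finally show ?thesis unfolding norm_mult norm_of_real by (intro mult_right_mono) auto
      qed
    qed
    also have "\<dots> = D * radius \<phi> ^ Suc n * (LINT s|lborel. cmod (fn \<phi> s))" by simp
    also have "\<dots> \<le> D * radius \<phi> ^ p * 2"
    proof (rule mult_mono)
      have "(LINT s|lborel. cmod (fn \<phi> s)) \<le> 1 + 1 / real n"
        using elim(1) by (simp add: mollifiers_def n_def)
      also have "\<dots> \<le> 2" by (simp add: n_def)
      finally show "(LINT s|lborel. cmod (fn \<phi> s)) \<le> 2" .
      have D: "D \<ge> 0" by (simp add: D_def)
      have "radius \<phi> ^ Suc n \<le> radius \<phi> ^ p"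
        using elim(2) by (intro power_decreasing) (auto simp: n_def)
      then show "D * radius \<phi> ^ Suc n \<le> D * radius \<phi> ^ p" using D by (rule mult_left_mono)
      show "0 \<le> D * radius \<phi> ^ p" using D elim(2) by simp
    qed simp
    finally show ?case by (simp add: mult_ac)
  qed
  then show "\<exists>C. \<forall>\<^sub>F \<phi> in U. \<forall>t\<in>{0}. cmod ((LINT s|lborel. of_real (exp (c * s)) * fn \<phi> s) - 1) \<le> C * radius \<phi> ^ p"
    by auto
qed

text \<open>
  The exponential function is an eigenfunction of the convolution with \<open>\<phi>\<close>, so the embedded net is the
  constant net multiplied by a generalized number, which is \<open>1\<close> by the preceding lemma.
\<close>
lemma iota_exp: "iota U (regular_dist (\<lambda>t. of_real (exp (c * t)))) = class_E U (\<lambda>\<phi> t. of_real (exp (c * t)))"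
proof -
  define E where "E t = complex_of_real (exp (c * t))" for t
  define B where "B \<phi> = (LINT s|lborel. of_real (exp (- c * s)) * fn \<phi> s) - 1" for \<phi>
  have B: "(\<lambda>\<phi> t. B \<phi>) \<in> negligible_E U"
    using mollified_exp_negligible[of "- c"] by (intro negligible_E_const) (simp add: B_def[abs_def])
  have E: "(\<lambda>\<phi>. E) \<in> moderate_E U"
    unfolding E_def[abs_def] by (rule moderate_E_fixed) (rule smooth_exp_real)
  have conv: "dist_conv_test (regular_dist E) \<phi> x = E x * B \<phi> + E x" for \<phi> x
  proof -
    have "dist_conv_test (regular_dist E) \<phi> x = (LINT t|lborel. E t * fn \<phi> (x - t))"
      by (simp add: dist_conv_test_def regular_dist_def reflect_test.rep_eq)
    also have "\<dots> = (LINT s|lborel. E (x - s) * fn \<phi> s)"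
      using lborel_integral_real_affine[of "-1" "\<lambda>t. E t * fn \<phi> (x - t)" x] by simp
    also have "\<dots> = (LINT s|lborel. E x * (of_real (exp (- c * s)) * fn \<phi> s))"
      by (intro Bochner_Integration.integral_cong) (auto simp: E_def exp_diff exp_minus right_diff_distrib field_simps)
    also have "\<dots> = E x * (LINT s|lborel. of_real (exp (- c * s)) * fn \<phi> s)"
      by (rule integral_mult_right_zero)
    finally show ?thesis by (simp add: B_def algebra_simps)
  qed
  have n: "(\<lambda>\<phi> t. E t * B \<phi>) \<in> negligible_E U" by (rule negligible_E_mult[OF E B])
  have "class_E U (\<lambda>\<phi> t. E t * B \<phi> + E t) = class_E U (\<lambda>\<phi>. E)"
    using n E by (subst class_E_eq_iff) (auto intro: moderate_E_add negligible_E_moderate_E)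
  moreover have "dist_conv_test (regular_dist E) = (\<lambda>\<phi> t. E t * B \<phi> + E t)"
    by (intro ext) (rule conv)
  ultimately show ?thesis
    unfolding iota_class E_def[abs_def, symmetric] by simp
qed

end

section \<open>The initial value problem\<close>

context mollifier_filter
begin

lemma solves_ivp_class:
  assumes "y \<in> moderate_E U" "F \<in> moderate_E U"
  shows "solves_ivp U a b (class_E U F) (class_E U y) \<longleftrightarrow>
    (\<lambda>\<phi> t. of_real a * vd (y \<phi>) t + of_real b * y \<phi> t - F \<phi> t) \<in> negligible_E U \<and>
    (\<lambda>\<phi>. y \<phi> 0) \<in> negligible_C U"
proof -
  have m: "(\<lambda>\<phi> t. of_real a * vd (y \<phi>) t + of_real b * y \<phi> t) \<in> moderate_E U"
    by (intro moderate_E_add moderate_E_cmult vd_moderate_E assms)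
  have "scale_hat U (number_hat U (of_real a)) (deriv_hat U (class_E U y))
       \<oplus>\<^bsub>E_hat U\<^esub> scale_hat U (number_hat U (of_real b)) (class_E U y) =
      class_E U (\<lambda>\<phi> t. of_real a * vd (y \<phi>) t + of_real b * y \<phi> t)"
    by (simp add: deriv_hat_class scale_number_hat_class class_E_add moderate_E_cmult vd_moderate_E assms(1))
  then show ?thesis
    by (simp add: solves_ivp_def carrier_E_hat assms(1) class_E_eq_iff[OF m assms(2)]
        value_hat_class class_C_eq_zero_iff)
qed

text \<open>
  The difference of two nets that solve the equation modulo negligible nets solves the homogeneous
  equation modulo negligible nets, so one common value (modulo a negligible net) makes them equal.
\<close>
lemma linear_ode_unique:
  assumes "a \<noteq> 0" and y: "y \<in> moderate_E U" and z: "z \<in> moderate_E U"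
    and eqs: "(\<lambda>\<phi> t. of_real a * vd (y \<phi>) t + of_real b * y \<phi> t - F \<phi> t) \<in> negligible_E U"
      "(\<lambda>\<phi> t. of_real a * vd (z \<phi>) t + of_real b * z \<phi> t - G \<phi> t) \<in> negligible_E U"
    and FG: "(\<lambda>\<phi> t. F \<phi> t - G \<phi> t) \<in> negligible_E U"
    and x0: "(\<lambda>\<phi>. y \<phi> x0 - z \<phi> x0) \<in> negligible_C U"
  shows "class_E U y = class_E U z"
proof -
  note vd = vd_diff[OF smooth_moderate_E[OF y] smooth_moderate_E[OF z]]
  have "(\<lambda>\<phi> t. (of_real a * vd (y \<phi>) t + of_real b * y \<phi> t - F \<phi> t) -
      (of_real a * vd (z \<phi>) t + of_real b * z \<phi> t - G \<phi> t) + (F \<phi> t - G \<phi> t)) \<in> negligible_E U"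
    by (intro negligible_E_add negligible_E_diff eqs FG)
  then have "(\<lambda>\<phi> t. of_real a * vd (\<lambda>t. y \<phi> t - z \<phi> t) t + of_real b * (y \<phi> t - z \<phi> t)) \<in> negligible_E U"
    by (simp add: vd algebra_simps)
  then have "(\<lambda>\<phi> t. y \<phi> t - z \<phi> t) \<in> negligible_E U"
    by (rule linear_ode_negligible[OF \<open>a \<noteq> 0\<close> moderate_E_diff[OF y z] _ x0])
  then show ?thesis by (simp add: class_E_eq_iff[OF y z])
qed

text \<open>
  The equation holds exactly for the representatives, not only modulo negligible nets: \<open>g \<star> S\<^sub>n\<close> solves
  \<open>a T' + b T = S\<^sub>n\<close>, and the convolution with \<open>\<phi>\<close> commutes with the derivative.
\<close>
lemma comb_net_green_equation:
  assumes "a \<noteq> 0" and S: "\<And>n. n \<in> {1..m} \<Longrightarrow> S n \<in> distributions_plus"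
  shows "of_real a * vd (comb_net m A (\<lambda>n. dist_conv (green a b) (S n)) \<phi>) t
    + of_real b * comb_net m A (\<lambda>n. dist_conv (green a b) (S n)) \<phi> t = comb_net m A S \<phi> t"
proof -
  let ?G = "\<lambda>n. dist_conv (green a b) (S n)"
  have G: "?G n \<in> distributions" if "n \<in> {1..m}" for n
    by (intro distributions_plus_distributions dist_conv_green_distributions_plus S that)
  have "(comb_net m A ?G \<phi> has_vector_derivative (\<Sum>n\<in>{1..m}. A n \<phi> * vd (dist_conv_test (?G n) \<phi>) t)) (at t)"
    unfolding comb_net_def[abs_def]
    by (intro has_vector_derivative_sum has_vector_derivative_mult_right
        smooth_has_vector_derivative smooth_dist_conv_test G)
  then have "vd (comb_net m A ?G \<phi>) t = (\<Sum>n\<in>{1..m}. A n \<phi> * vd (dist_conv_test (?G n) \<phi>) t)"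
    by (simp add: vd_def vector_derivative_at)
  then have "of_real a * vd (comb_net m A ?G \<phi>) t + of_real b * comb_net m A ?G \<phi> t =
      (\<Sum>n\<in>{1..m}. A n \<phi> * (of_real a * vd (dist_conv_test (?G n) \<phi>) t + of_real b * dist_conv_test (?G n) \<phi> t))"
    by (simp add: comb_net_def sum_distrib_left sum.distrib algebra_simps)
  also have "\<dots> = (\<Sum>n\<in>{1..m}. A n \<phi> * dist_conv_test (S n) \<phi> t)"
  proof (intro sum.cong refl arg_cong2[where f = "(*)"])
    fix n assume n: "n \<in> {1..m}"
    show "of_real a * vd (dist_conv_test (?G n) \<phi>) t + of_real b * dist_conv_test (?G n) \<phi> t = dist_conv_test (S n) \<phi> t"
      using dist_conv_green_equation[OF \<open>a \<noteq> 0\<close> S[OF n]]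
      unfolding dist_conv_test_dist_deriv[OF G[OF n], symmetric] by (simp add: dist_conv_test_def)
  qed
  finally show ?thesis by (simp add: comb_net_def)
qed

lemma comb_net_vanishes:
  assumes "\<And>n. n \<in> {1..m} \<Longrightarrow> S n \<in> distributions_plus"
  shows "(\<lambda>\<phi>. comb_net m A S \<phi> (-1)) \<in> negligible_C U"
proof -
  \<comment> \<open>The value is exactly \<open>0\<close> as soon as \<open>R\<^sub>\<phi> < 1\<close>.\<close>
  have ev: "\<forall>\<^sub>F \<phi> in U. cmod (comb_net m A S \<phi> (-1)) \<le> radius \<phi> ^ p" for p
    using ev_radius_less[OF zero_less_one]
  proof eventually_elim
    case (elim \<phi>)
    have "dist_conv_test (S n) \<phi> (-1) = 0" if "n \<in> {1..m}" for n
      by (rule dist_conv_test_plus_eq_0[OF assms[OF that], of "radius \<phi>"])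
        (use elim fn_eq_0_outside_radius in auto)
    then show ?case using elim by (simp add: comb_net_def)
  qed
  then show ?thesis by (simp add: negligible_C_def)
qed

text \<open>
  The convolution is well defined: two representations of \<open>f\<close> lead to solutions of \<open>a h' + b h = f\<close>
  that both vanish at \<open>-1\<close>, because convolutions of distributions supported in \<open>[0, \<infinity>)\<close> with \<open>\<phi>\<close>
  vanish to the left of \<open>-R\<^sub>\<phi>\<close>.
\<close>
lemma conv_hat_green:
  assumes "a \<noteq> 0"
    and A: "\<And>n. n \<in> {1..m} \<Longrightarrow> A n \<in> moderate_C U \<and> S n \<in> distributions_plus"
    and \<alpha>: "\<And>n. n \<in> {1..m} \<Longrightarrow> \<alpha> n = class_C U (A n)"
  shows "conv_hat U (green a b) (lin_comb U m \<alpha> S) = lin_comb U m \<alpha> (\<lambda>n. dist_conv (green a b) (S n))"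
  unfolding conv_hat_def
proof (rule the_equality)
  show "\<exists>m' \<alpha>' S'. (\<forall>n\<in>{1..m'}. \<alpha>' n \<in> carrier (C_hat U) \<and> S' n \<in> distributions_plus) \<and>
     lin_comb U m \<alpha> S = lin_comb U m' \<alpha>' S' \<and>
     lin_comb U m \<alpha> (\<lambda>n. dist_conv (green a b) (S n)) = lin_comb U m' \<alpha>' (\<lambda>n. dist_conv (green a b) (S' n))"
    using A \<alpha> by (intro exI[of _ m] exI[of _ \<alpha>] exI[of _ S]) (auto simp: carrier_C_hat)
next
  fix h assume "\<exists>m' \<alpha>' S'. (\<forall>n\<in>{1..m'}. \<alpha>' n \<in> carrier (C_hat U) \<and> S' n \<in> distributions_plus) \<and>
     lin_comb U m \<alpha> S = lin_comb U m' \<alpha>' S' \<and> h = lin_comb U m' \<alpha>' (\<lambda>n. dist_conv (green a b) (S' n))"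
  then obtain m' \<alpha>' S' where \<alpha>S: "\<forall>n\<in>{1..m'}. \<alpha>' n \<in> carrier (C_hat U) \<and> S' n \<in> distributions_plus"
    and eq: "lin_comb U m \<alpha> S = lin_comb U m' \<alpha>' S'"
    and h: "h = lin_comb U m' \<alpha>' (\<lambda>n. dist_conv (green a b) (S' n))" by blast
  then have "\<forall>n\<in>{1..m'}. \<exists>A. A \<in> moderate_C U \<and> \<alpha>' n = class_C U A"
    by (auto simp: carrier_C_hat)
  then obtain A' where A': "\<And>n. n \<in> {1..m'} \<Longrightarrow> A' n \<in> moderate_C U \<and> \<alpha>' n = class_C U (A' n)"
    by metis
  let ?G = "\<lambda>n. dist_conv (green a b) (S n)" and ?G' = "\<lambda>n. dist_conv (green a b) (S' n)"
  have S: "\<And>n. n \<in> {1..m} \<Longrightarrow> S n \<in> distributions_plus" "\<And>n. n \<in> {1..m'} \<Longrightarrow> S' n \<in> distributions_plus"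
    using A \<alpha>S by auto
  have G: "\<And>n. n \<in> {1..m} \<Longrightarrow> ?G n \<in> distributions_plus" "\<And>n. n \<in> {1..m'} \<Longrightarrow> ?G' n \<in> distributions_plus"
    by (intro dist_conv_green_distributions_plus S; assumption)+
  note [simp] = distributions_plus_distributions
  have F: "comb_net m A S \<in> moderate_E U" "comb_net m' A' S' \<in> moderate_E U"
    and W: "comb_net m A ?G \<in> moderate_E U" "comb_net m' A' ?G' \<in> moderate_E U"
    by (rule moderate_comb_net; use A A' S G in simp)+
  have "class_E U (comb_net m' A' ?G') = class_E U (comb_net m A ?G)"
  proof (rule linear_ode_unique[OF \<open>a \<noteq> 0\<close> W(2,1), of b])
    show "(\<lambda>\<phi> t. of_real a * vd (comb_net m' A' ?G' \<phi>) t + of_real b * comb_net m' A' ?G' \<phi> t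
        - comb_net m' A' S' \<phi> t) \<in> negligible_E U"
      using comb_net_green_equation[OF \<open>a \<noteq> 0\<close> S(2)] by (simp add: negligible_E_zero)
    show "(\<lambda>\<phi> t. of_real a * vd (comb_net m A ?G \<phi>) t + of_real b * comb_net m A ?G \<phi> t
        - comb_net m A S \<phi> t) \<in> negligible_E U"
      using comb_net_green_equation[OF \<open>a \<noteq> 0\<close> S(1)] by (simp add: negligible_E_zero)
    have "class_E U (comb_net m A S) = class_E U (comb_net m' A' S')"
      using eq lin_comb_class[of m A S \<alpha>] lin_comb_class[of m' A' S' \<alpha>'] A A' \<alpha> S by simp
    then show "(\<lambda>\<phi> t. comb_net m' A' S' \<phi> t - comb_net m A S \<phi> t) \<in> negligible_E U"
      using class_E_eq_iff[OF F(2,1)] by simp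
    show "(\<lambda>\<phi>. comb_net m' A' ?G' \<phi> (-1) - comb_net m A ?G \<phi> (-1)) \<in> negligible_C U"
      by (intro negligible_C_diff comb_net_vanishes G)
  qed
  then show "h = lin_comb U m \<alpha> ?G"
    using lin_comb_class[of m A ?G \<alpha>] lin_comb_class[of m' A' ?G' \<alpha>'] A A' \<alpha> G h by simp
qed

text \<open>
  Variation of constants: \<open>g \<star> f\<close> is a particular solution, and subtracting a multiple of the solution
  \<open>e\<^bsup>-(b/a)t\<^esup>\<close> of the homogeneous equation corrects its value at \<open>0\<close>.
\<close>
theorem ivp_span_hat:
  assumes "a \<noteq> 0" and f: "f \<in> span_hat U distributions_plus"
  shows "conv_hat U (green a b) f \<in> span_hat U distributions_plus"
    and "value_hat U (conv_hat U (green a b) f) 0 \<in> carrier (C_hat U)"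
    and "\<exists>!y. solves_ivp U a b f y"
    and "solves_ivp U a b f
         (conv_hat U (green a b) f \<ominus>\<^bsub>E_hat U\<^esub>
            scale_hat U (value_hat U (conv_hat U (green a b) f) 0)
              (iota U (regular_dist (\<lambda>t. of_real (exp (- (b / a) * t))))))"
proof -
  obtain m \<alpha> S where f_eq: "f = lin_comb U m \<alpha> S"
    and \<alpha>S: "\<forall>n\<in>{1..m}. \<alpha> n \<in> carrier (C_hat U) \<and> S n \<in> distributions_plus"
    using f by (auto simp: span_hat_def)
  then have "\<forall>n\<in>{1..m}. \<exists>A. A \<in> moderate_C U \<and> \<alpha> n = class_C U A"
    by (auto simp: carrier_C_hat)
  then obtain A where A: "\<And>n. n \<in> {1..m} \<Longrightarrow> A n \<in> moderate_C U \<and> \<alpha> n = class_C U (A n)"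
    by metis
  let ?G = "\<lambda>n. dist_conv (green a b) (S n)"
  have S: "S n \<in> distributions_plus" and G: "?G n \<in> distributions_plus" if "n \<in> {1..m}" for n
    using \<alpha>S that by (auto intro: dist_conv_green_distributions_plus)
  note [simp] = distributions_plus_distributions
  define F where "F = comb_net m A S"
  define W where "W = comb_net m A ?G"
  define E where "E t = complex_of_real (exp (- (b / a) * t))" for t
  define y where "y = (\<lambda>\<phi> t. W \<phi> t - W \<phi> 0 * E t)"
  have F: "F \<in> moderate_E U" and W: "W \<in> moderate_E U"
    unfolding F_def W_def by (rule moderate_comb_net; use A S G in simp)+
  have fF: "f = class_E U F"
    unfolding f_eq F_def by (rule lin_comb_class) (use A S in auto)
  have conv: "conv_hat U (green a b) f = lin_comb U m \<alpha> ?G"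
    unfolding f_eq by (rule conv_hat_green[OF \<open>a \<noteq> 0\<close>, of m A]) (use A S in auto)
  also have "\<dots> = class_E U W"
    unfolding W_def by (rule lin_comb_class) (use A G in auto)
  finally have convW: "conv_hat U (green a b) f = class_E U W" .
  show "conv_hat U (green a b) f \<in> span_hat U distributions_plus"
    unfolding conv span_hat_def using \<alpha>S G by blast
  show "value_hat U (conv_hat U (green a b) f) 0 \<in> carrier (C_hat U)"
    by (simp add: convW value_hat_class W carrier_C_hat value_moderate_E)
  have E: "smooth E" "vd E = (\<lambda>t. - of_real (b / a) * E t)"
    using smooth_exp_real[of "- (b / a)"] vd_exp_real[of "- (b / a)"] by (simp_all add: E_def[abs_def])
  have WE: "(\<lambda>\<phi> t. W \<phi> 0 * E t) \<in> moderate_E U"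
    by (intro moderate_E_mult moderate_E_const value_moderate_E W moderate_E_fixed E)
  have y: "y \<in> moderate_E U"
    unfolding y_def by (rule moderate_E_diff[OF W WE])
  have "conv_hat U (green a b) f \<ominus>\<^bsub>E_hat U\<^esub> scale_hat U (value_hat U (conv_hat U (green a b) f) 0)
      (iota U (regular_dist E)) = class_E U y"
    using iota_exp[of "- (b / a)"] unfolding convW value_hat_class[OF W] E_def[abs_def, symmetric]
    by (simp add: scale_hat_class value_moderate_E W moderate_E_fixed E class_E_diff WE y_def)
  moreover have sol: "solves_ivp U a b f (class_E U y)"
    unfolding fF solves_ivp_class[OF y F]
  proof
    have "of_real a * vd (y \<phi>) t + of_real b * y \<phi> t - F \<phi> t = 0" for \<phi> t
    proof -
      have "vd (y \<phi>) t = vd (W \<phi>) t + W \<phi> 0 * of_real (b / a) * E t"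
        unfolding y_def vd_diff[OF smooth_moderate_E[OF W] smooth_cmult[OF E(1)]]
          vd_cmult[OF smooth_differentiable[OF E(1)]] by (simp add: E(2))
      then have "of_real a * vd (y \<phi>) t + of_real b * y \<phi> t = of_real a * vd (W \<phi>) t + of_real b * W \<phi> t"
        using \<open>a \<noteq> 0\<close> by (simp add: y_def field_simps)
      also have "\<dots> = F \<phi> t"
        unfolding W_def F_def by (rule comb_net_green_equation[OF \<open>a \<noteq> 0\<close> S])
      finally show ?thesis by simp
    qed
    then show "(\<lambda>\<phi> t. of_real a * vd (y \<phi>) t + of_real b * y \<phi> t - F \<phi> t) \<in> negligible_E U"
      by (simp add: negligible_E_zero)
    show "(\<lambda>\<phi>. y \<phi> 0) \<in> negligible_C U"
      by (simp add: y_def E_def negligible_C_zero)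
  qed
  ultimately show "solves_ivp U a b f
         (conv_hat U (green a b) f \<ominus>\<^bsub>E_hat U\<^esub>
            scale_hat U (value_hat U (conv_hat U (green a b) f) 0)
              (iota U (regular_dist (\<lambda>t. of_real (exp (- (b / a) * t))))))"
    by (simp add: E_def[abs_def])
  show "\<exists>!y. solves_ivp U a b f y"
  proof (rule ex1I[where P = "solves_ivp U a b f", OF sol])
    fix Z assume Z: "solves_ivp U a b f Z"
    then obtain z where z: "z \<in> moderate_E U" "Z = class_E U z"
      by (auto simp: solves_ivp_def carrier_E_hat)
    have "class_E U z = class_E U y"
    proof (rule linear_ode_unique[OF \<open>a \<noteq> 0\<close> z(1) y, of b F F 0])
      show "(\<lambda>\<phi>. z \<phi> 0 - y \<phi> 0) \<in> negligible_C U"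
        using Z sol unfolding fF z(2) solves_ivp_class[OF y F] solves_ivp_class[OF z(1) F]
        by (intro negligible_C_diff) auto
    qed (use Z sol in \<open>auto simp: fF z(2) solves_ivp_class[OF y F] solves_ivp_class[OF z(1) F] negligible_E_zero\<close>)
    then show "Z = class_E U y" using z(2) by simp
  qed
qed

end

theorem theorem7:
  fixes U :: "test_fun filter" and a b :: real and g :: "test_fun \<Rightarrow> complex"
  assumes "admissible_ultrafilter U"
    and "a \<noteq> 0"
    and "g = regular_dist (\<lambda>t. of_real (1 / a * heaviside t * exp (- (b / a) * t)))"
  shows "g \<in> distributions_plus \<and>
    g = green_function [:of_real b, of_real a:] \<and>
    (\<forall>f \<in> span_hat U distributions_plus.
       conv_hat U g f \<in> span_hat U distributions_plus \<and>
       value_hat U (conv_hat U g f) 0 \<in> carrier (C_hat U) \<and>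
       (\<exists>!y. solves_ivp U a b f y) \<and>
       solves_ivp U a b f
         (conv_hat U g f \<ominus>\<^bsub>E_hat U\<^esub>
            scale_hat U (value_hat U (conv_hat U g f) 0)
              (iota U (regular_dist (\<lambda>t. of_real (exp (- (b / a) * t)))))))"
proof -
  interpret mollifier_filter U
    by unfold_locales (use assms(1) in \<open>simp add: admissible_ultrafilter_def\<close>)
  have g: "g = green a b"
    by (simp only: assms(3) green_density_def[abs_def])
  have "g \<in> distributions_plus"
    using dist_conv_green_distributions_plus[OF dirac_distributions_plus, of a b]
    by (simp add: g dist_conv_green_dirac)
  moreover have "g = green_function [:of_real b, of_real a:]"
    by (simp add: g green_function_eq[OF \<open>a \<noteq> 0\<close>])
  ultimately show ?thesis
    unfolding g using ivp_span_hat[OF \<open>a \<noteq> 0\<close>] by blast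
qed

end
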